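(* Let $\mathcal{A}$ be a unital C*-algebra, let $\pi:\mathcal{A}\to\mathbf{L}(\mathcal{H})$ be a faithful atomic representation, and let $\rho_1$ and $\rho_2$ be quantum metrics on $\mathfrak{q}\mathcal{A}$ with respect to the same representation $\pi$. Then, for every positive real number $r$, $\rho_1+r\rho_2$ is a quantum metric on $\mathfrak{q}\mathcal{A}$ with respect to $\pi$.
   Context: Notation: $\check{\otimes}$ denotes the spatial (minimal) tensor product of C*-algebras; $\bar{\otimes}$ denotes the Hilbert space tensor product (for Hilbert spaces) and the von Neumann algebra tensor product (for von Neumann algebras); $\mathbf{L}(\mathcal{H})$ is the algebra of bounded operators on the Hilbert space $\mathcal{H}$. The symbol $\mathfrak{q}\mathcal{A}$ is just notation for the "compact noncommutative space" associated to the unital C*-algebra $\mathcal{A}$. Atomic representation: a representation $\pi$ of $\mathcal{A}$ on a Hilbert space $\mathcal{H}$ is called atomic if there is a family $\{\pi_i:\mathcal{A}\to\mathbf{L}(\mathcal{H}_i)\}$ of pairwise inequivalent irreducible representations of $\mathcal{A}$ with $\pi=\bigoplus_i\pi_i$ (so $\mathcal{H}=\bigoplus_i\mathcal{H}_i$ and $\pi(\mathcal{A})''=\bigoplus_i\mathbf{L}(\mathcal{H}_i)$). Let $\pi:\mathcal{A}\to\mathbf{L}(\mathcal{H})$ be a faithful atomic representation; regard $\mathcal{A}\subseteq\mathbf{L}(\mathcal{H})$ via $\pi$, write $\mathcal{A}''=\pi(\mathcal{A})''$, and regard $\mathcal{A}\check{\otimes}\mathcal{A}\subseteq\mathcal{A}''\bar{\otimes}\mathcal{A}''\subseteq\mathbf{L}(\mathcal{H}\bar{\otimes}\mathcal{H})$.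 Let $P_\delta\in\mathcal{A}''\bar{\otimes}\mathcal{A}''$ be the supremum of all projections of the form $p\otimes p$ with $p\in\mathcal{A}''$ a minimal projection, and let $\mathcal{H}_\delta\subseteq\mathcal{H}\bar{\otimes}\mathcal{H}$ be the image of $P_\delta$. Quantum metric: an element $\rho\in\mathcal{A}\check{\otimes}\mathcal{A}$ is a (compatible) quantum metric on $\mathfrak{q}\mathcal{A}$ with respect to $\pi$ if: (i)$'$ $\rho$ is a positive element of $\mathcal{A}\check{\otimes}\mathcal{A}$; (ii)$'$ $\rho P_\delta=P_\delta\rho=0$; (iii)$'$ $0$ is not an eigenvalue of the operator $\rho|_{\mathcal{H}_\delta^\perp}\in\mathbf{L}(\mathcal{H}_\delta^\perp)$; (iv)$'$ $\mathfrak{F}(\rho)=\rho$, where $\mathfrak{F}:\mathcal{A}\check{\otimes}\mathcal{A}\to\mathcal{A}\check{\otimes}\mathcal{A}$ is the flip $a\otimes b\mapsto b\otimes a$; (v)$'$ $\mathfrak{M}(\rho)\leq\rho\otimes1+1\otimes\rho$ in $\mathcal{A}\check{\otimes}\mathcal{A}\check{\otimes}\mathcal{A}$, where $\mathfrak{M}:\mathcal{A}\check{\otimes}\mathcal{A}\to\mathcal{A}\check{\otimes}\mathcal{A}\check{\otimes}\mathcal{A}$ is the *-morphism with $\mathfrak{M}(a\otimes b)=a\otimes1\otimes b$. *)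

theory Defs
  imports "HOL-Analysis.Analysis"
begin

section \<open>Complex normed spaces, Hilbert spaces and unital C*-algebras\<close>

class scaleC = scaleR +
  fixes scaleC :: "complex \<Rightarrow> 'a \<Rightarrow> 'a"  (infixr "*\<^sub>C" 75)
  assumes scaleR_scaleC: "r *\<^sub>R x = complex_of_real r *\<^sub>C x"

class complex_vector = scaleC + ab_group_add +
  assumes scaleC_add_right: "a *\<^sub>C (x + y) = a *\<^sub>C x + a *\<^sub>C y"
    and scaleC_add_left: "(a + b) *\<^sub>C x = a *\<^sub>C x + b *\<^sub>C x"
    and scaleC_scaleC: "a *\<^sub>C (b *\<^sub>C x) = (a * b) *\<^sub>C x"
    and scaleC_one: "1 *\<^sub>C x = x"

global_interpretation complex_vector:
  vector_space "scaleC :: complex \<Rightarrow> 'a \<Rightarrow> 'a::complex_vector"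
  defines csubspace = complex_vector.subspace
    and cspan = complex_vector.span
  by unfold_locales
    (simp_all add: scaleC_add_right scaleC_add_left scaleC_scaleC scaleC_one)

class complex_normed_vector = complex_vector + real_normed_vector +
  assumes norm_scaleC: "norm (a *\<^sub>C x) = cmod a * norm x"

text \<open>The inner product is antilinear in the first and linear in the second argument.\<close>

class chilbert_space = complex_normed_vector + complete_space +
  fixes cinner :: "'a \<Rightarrow> 'a \<Rightarrow> complex"
  assumes cinner_commute: "cinner x y = cnj (cinner y x)"
    and cinner_add_right: "cinner x (y + z) = cinner x y + cinner x z"
    and cinner_scaleC_right: "cinner x (a *\<^sub>C y) = a * cinner x y"
    and cinner_self: "cinner x x = complex_of_real ((norm x)\<^sup>2)"

text \<open>The zero algebra is not excluded: \<open>real_normed_algebra_1\<close> would force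
  \<open>0 \<noteq> 1\<close>. If \<open>0 \<noteq> 1\<close>, then \<open>norm 1 = 1\<close> follows from the C*-identity.\<close>

class unital_cstar_algebra =
  complex_normed_vector + real_normed_algebra + monoid_mult + complete_space +
  fixes cstar :: "'a \<Rightarrow> 'a"
  assumes mult_scaleC_left: "(a *\<^sub>C x) * y = a *\<^sub>C (x * y)"
    and mult_scaleC_right: "x * (a *\<^sub>C y) = a *\<^sub>C (x * y)"
    and cstar_add: "cstar (x + y) = cstar x + cstar y"
    and cstar_scaleC: "cstar (a *\<^sub>C x) = cnj a *\<^sub>C cstar x"
    and cstar_mult: "cstar (x * y) = cstar y * cstar x"
    and cstar_cstar: "cstar (cstar x) = x"
    and cstar_identity: "norm (cstar x * x) = (norm x)\<^sup>2"

section \<open>Bounded operators\<close>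

text \<open>\<open>blinfun\<close> consists of the bounded \<^emph>\<open>real\<close>-linear maps; the algebra of bounded
  operators on a Hilbert space is its subset \<open>bounded_ops\<close>. The norm and the
  composition are those of \<open>blinfun\<close>.\<close>

type_synonym 'h op = "'h \<Rightarrow>\<^sub>L 'h"

instantiation blinfun :: (real_normed_vector, complex_normed_vector) complex_normed_vector
begin

lift_definition scaleC_blinfun :: "complex \<Rightarrow> 'a \<Rightarrow>\<^sub>L 'b \<Rightarrow> 'a \<Rightarrow>\<^sub>L 'b"
  is "\<lambda>c f x. c *\<^sub>C f x"
proof -
  fix c :: complex and f :: "'a \<Rightarrow> 'b"
  assume f: "bounded_linear f"
  then interpret bounded_linear f .
  obtain K where K: "\<And>x. norm (f x) \<le> norm x * K"
    using bounded by blast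
  show "bounded_linear (\<lambda>x. c *\<^sub>C f x)"
  proof (rule bounded_linear_intro)
    show "norm (c *\<^sub>C f x) \<le> norm x * (cmod c * K)" for x
      using mult_left_mono[OF K[of x], of "cmod c"] by (simp add: norm_scaleC ac_simps)
  qed (simp_all add: add scale scaleC_add_right scaleR_scaleC scaleC_scaleC mult.commute)
qed

instance
proof
  fix c :: complex and f :: "'a \<Rightarrow>\<^sub>L 'b"
  show "norm (c *\<^sub>C f) = cmod c * norm f"
  proof (cases "c = 0")
    case True
    then have "c *\<^sub>C f = 0"
      by (intro blinfun_eqI) (simp add: scaleC_blinfun.rep_eq)
    then show ?thesis using True by simp
  next
    case False
    have le: "norm (d *\<^sub>C g) \<le> cmod d * norm g" for d :: complex and g :: "'a \<Rightarrow>\<^sub>L 'b"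
    proof (rule norm_blinfun_bound)
      show "norm (blinfun_apply (d *\<^sub>C g) x) \<le> cmod d * norm g * norm x" for x
        using mult_left_mono[OF norm_blinfun[of g x], of "cmod d"]
        by (simp add: scaleC_blinfun.rep_eq norm_scaleC ac_simps)
    qed simp
    have "norm f = norm (inverse c *\<^sub>C (c *\<^sub>C f))"
      using False
      by (intro arg_cong[where f = norm] blinfun_eqI)
        (simp add: scaleC_blinfun.rep_eq scaleC_scaleC scaleC_one)
    also have "\<dots> \<le> cmod (inverse c) * norm (c *\<^sub>C f)"
      by (rule le)
    finally have "cmod c * norm f \<le> norm (c *\<^sub>C f)"
      using False by (simp add: norm_divide field_simps)
    with le show ?thesis by (meson antisym)
  qed
qed (transfer; simp add: scaleR_scaleC scaleC_add_right scaleC_add_left scaleC_scaleC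
      scaleC_one fun_eq_iff)+

end

definition bounded_ops :: "'h::chilbert_space op set" where
  "bounded_ops = {T :: 'h op. \<forall>c x. T (c *\<^sub>C x) = c *\<^sub>C T x}"

definition cadj :: "'h::chilbert_space op \<Rightarrow> 'h op" where
  "cadj T = (THE S :: 'h op. \<forall>x y. cinner (T x) y = cinner x (S y))"

definition commutant :: "'h::chilbert_space op set \<Rightarrow> 'h op set" where
  "commutant M = {S \<in> bounded_ops. \<forall>T\<in>M. S o\<^sub>L T = T o\<^sub>L S}"

text \<open>\<open>B\<close> is meant to be a C*-algebra of operators; the root \<open>S\<close> is taken in \<open>B\<close> itself.\<close>

definition positive_in :: "'h::chilbert_space op set \<Rightarrow> 'h op \<Rightarrow> bool" where
  "positive_in B T \<longleftrightarrow> (\<exists>S\<in>B. T = cadj S o\<^sub>L S)"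

definition le_in :: "'h::chilbert_space op set \<Rightarrow> 'h op \<Rightarrow> 'h op \<Rightarrow> bool" where
  "le_in B S T \<longleftrightarrow> S \<in> B \<and> T \<in> B \<and> positive_in B (T - S)"

definition eigenvalue_on :: "'h::chilbert_space set \<Rightarrow> 'h op \<Rightarrow> complex \<Rightarrow> bool" where
  "eigenvalue_on V T c \<longleftrightarrow> (\<exists>x\<in>V. x \<noteq> 0 \<and> T x = c *\<^sub>C x)"

definition orth_compl :: "'h::chilbert_space set \<Rightarrow> 'h set" where
  "orth_compl V = {x. \<forall>y\<in>V. cinner y x = 0}"

definition star_morphism ::
  "'h::chilbert_space op set \<Rightarrow> 'k::chilbert_space op set \<Rightarrow> ('h op \<Rightarrow> 'k op) \<Rightarrow> bool" where
  "star_morphism B C \<Phi> \<longleftrightarrow>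
     \<Phi> ` B \<subseteq> C \<and>
     (\<forall>S\<in>B. \<forall>T\<in>B. \<Phi> (S + T) = \<Phi> S + \<Phi> T) \<and>
     (\<forall>c. \<forall>T\<in>B. \<Phi> (c *\<^sub>C T) = c *\<^sub>C \<Phi> T) \<and>
     (\<forall>S\<in>B. \<forall>T\<in>B. \<Phi> (S o\<^sub>L T) = \<Phi> S o\<^sub>L \<Phi> T) \<and>
     (\<forall>T\<in>B. \<Phi> (cadj T) = cadj (\<Phi> T))"

section \<open>Projections\<close>

definition projections :: "'h::chilbert_space op set \<Rightarrow> 'h op set" where
  "projections M = {p \<in> M. p o\<^sub>L p = p \<and> cadj p = p}"

definition proj_le :: "'h::chilbert_space op \<Rightarrow> 'h op \<Rightarrow> bool" where
  "proj_le q p \<longleftrightarrow> p o\<^sub>L q = q"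

definition minimal_projections :: "'h::chilbert_space op set \<Rightarrow> 'h op set" where
  "minimal_projections M =
     {p \<in> projections M. p \<noteq> 0 \<and> (\<forall>q\<in>projections M. proj_le q p \<longrightarrow> q = 0 \<or> q = p)}"

text \<open>Well defined when \<open>M\<close> is a von Neumann algebra, whose projections form a complete
  lattice.\<close>

definition proj_Sup :: "'h::chilbert_space op set \<Rightarrow> 'h op set \<Rightarrow> 'h op" where
  "proj_Sup M X = (THE p. p \<in> projections M \<and> (\<forall>q\<in>X. proj_le q p) \<and>
     (\<forall>p'\<in>projections M. (\<forall>q\<in>X. proj_le q p') \<longrightarrow> proj_le p p'))"

section \<open>Atomic representations\<close>

definition representation :: "('a::unital_cstar_algebra \<Rightarrow> 'h::chilbert_space op) \<Rightarrow> bool" where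
  "representation \<pi> \<longleftrightarrow>
     range \<pi> \<subseteq> bounded_ops \<and>
     (\<forall>a b. \<pi> (a + b) = \<pi> a + \<pi> b) \<and>
     (\<forall>c a. \<pi> (c *\<^sub>C a) = c *\<^sub>C \<pi> a) \<and>
     (\<forall>a b. \<pi> (a * b) = \<pi> a o\<^sub>L \<pi> b) \<and>
     (\<forall>a. \<pi> (cstar a) = cadj (\<pi> a)) \<and>
     \<pi> 1 = id_blinfun"

definition invariant_subspace :: "('a \<Rightarrow> 'h::chilbert_space op) \<Rightarrow> 'h set \<Rightarrow> bool" where
  "invariant_subspace \<pi> V \<longleftrightarrow> csubspace V \<and> closed V \<and> (\<forall>a. \<pi> a ` V \<subseteq> V)"

definition irreducible_on :: "('a \<Rightarrow> 'h::chilbert_space op) \<Rightarrow> 'h set \<Rightarrow> bool" where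
  "irreducible_on \<pi> V \<longleftrightarrow> invariant_subspace \<pi> V \<and> V \<noteq> {0} \<and>
     (\<forall>W. invariant_subspace \<pi> W \<and> W \<subseteq> V \<longrightarrow> W = {0} \<or> W = V)"

text \<open>Unitary equivalence of the subrepresentations on the invariant subspaces \<open>V\<close> and \<open>W\<close>.\<close>

definition equivalent_on :: "('a \<Rightarrow> 'h::chilbert_space op) \<Rightarrow> 'h set \<Rightarrow> 'h set \<Rightarrow> bool" where
  "equivalent_on \<pi> V W \<longleftrightarrow> (\<exists>U :: 'h \<Rightarrow> 'h. bij_betw U V W \<and>
     (\<forall>x\<in>V. \<forall>y\<in>V. U (x + y) = U x + U y) \<and>
     (\<forall>c. \<forall>x\<in>V. U (c *\<^sub>C x) = c *\<^sub>C U x) \<and>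
     (\<forall>x\<in>V. \<forall>y\<in>V. cinner (U x) (U y) = cinner x y) \<and>
     (\<forall>a. \<forall>x\<in>V. U (\<pi> a x) = \<pi> a (U x)))"

text \<open>The direct sum decomposition is internal: \<open>\<V>\<close> is the set of the summands of \<open>\<H>\<close>.\<close>

definition atomic_representation ::
  "('a::unital_cstar_algebra \<Rightarrow> 'h::chilbert_space op) \<Rightarrow> bool" where
  "atomic_representation \<pi> \<longleftrightarrow> representation \<pi> \<and>
     (\<exists>\<V> :: 'h set set.
        (\<forall>V\<in>\<V>. irreducible_on \<pi> V) \<and>
        (\<forall>V\<in>\<V>. \<forall>W\<in>\<V>. V \<noteq> W \<longrightarrow> \<not> equivalent_on \<pi> V W) \<and>
        (\<forall>V\<in>\<V>. \<forall>W\<in>\<V>. V \<noteq> W \<longrightarrow> (\<forall>x\<in>V. \<forall>y\<in>W. cinner x y = 0)) \<and>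
        closure (cspan (\<Union>\<V>)) = UNIV)"

section \<open>Tensor products\<close>

text \<open>The type \<open>'l\<close> with the map \<open>\<tau>\<close> is a realization of the Hilbert space tensor product
  of \<open>'h\<close> and \<open>'k\<close>; this determines \<open>'l\<close> up to a unique unitary respecting the elementary
  tensors.\<close>

definition hilbert_tensor ::
  "('h::chilbert_space \<Rightarrow> 'k::chilbert_space \<Rightarrow> 'l::chilbert_space) \<Rightarrow> bool" where
  "hilbert_tensor \<tau> \<longleftrightarrow>
     (\<forall>x x' y. \<tau> (x + x') y = \<tau> x y + \<tau> x' y) \<and>
     (\<forall>x y y'. \<tau> x (y + y') = \<tau> x y + \<tau> x y') \<and>
     (\<forall>c x y. \<tau> (c *\<^sub>C x) y = c *\<^sub>C \<tau> x y) \<and>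
     (\<forall>c x y. \<tau> x (c *\<^sub>C y) = c *\<^sub>C \<tau> x y) \<and>
     (\<forall>x x' y y'. cinner (\<tau> x y) (\<tau> x' y') = cinner x x' * cinner y y') \<and>
     closure (cspan {\<tau> x y | x y. True}) = UNIV"

text \<open>A realization \<open>'h2\<close> of the tensor square and a common realization \<open>'h3\<close> of
  \<open>(\<H> \<otimes> \<H>) \<otimes> \<H>\<close> (via \<open>\<tau>l\<close>) and \<open>\<H> \<otimes> (\<H> \<otimes> \<H>)\<close> (via \<open>\<tau>r\<close>), with the associator as the
  identity.\<close>

definition hilbert_tensor_powers ::
  "('h::chilbert_space \<Rightarrow> 'h \<Rightarrow> 'h2::chilbert_space) \<Rightarrow>
   ('h2 \<Rightarrow> 'h \<Rightarrow> 'h3::chilbert_space) \<Rightarrow> ('h \<Rightarrow> 'h2 \<Rightarrow> 'h3) \<Rightarrow> bool" where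
  "hilbert_tensor_powers \<tau> \<tau>l \<tau>r \<longleftrightarrow>
     hilbert_tensor \<tau> \<and> hilbert_tensor \<tau>l \<and> hilbert_tensor \<tau>r \<and>
     (\<forall>x y z. \<tau>l (\<tau> x y) z = \<tau>r x (\<tau> y z))"

definition op_tensor ::
  "('h::chilbert_space \<Rightarrow> 'k::chilbert_space \<Rightarrow> 'l::chilbert_space) \<Rightarrow> 'h op \<Rightarrow> 'k op \<Rightarrow> 'l op"
  where
  "op_tensor \<tau> S T = (THE R :: 'l op. R \<in> bounded_ops \<and> (\<forall>x y. R (\<tau> x y) = \<tau> (S x) (T y)))"

definition spatial_tensor ::
  "('h::chilbert_space \<Rightarrow> 'k::chilbert_space \<Rightarrow> 'l::chilbert_space) \<Rightarrow>
   'h op set \<Rightarrow> 'k op set \<Rightarrow> 'l op set" where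
  "spatial_tensor \<tau> B C = closure (cspan {op_tensor \<tau> S T | S T. S \<in> B \<and> T \<in> C})"

definition vN_tensor ::
  "('h::chilbert_space \<Rightarrow> 'k::chilbert_space \<Rightarrow> 'l::chilbert_space) \<Rightarrow>
   'h op set \<Rightarrow> 'k op set \<Rightarrow> 'l op set" where
  "vN_tensor \<tau> M N = commutant (commutant {op_tensor \<tau> S T | S T. S \<in> M \<and> T \<in> N})"

section \<open>Quantum metrics\<close>

text \<open>In the following, \<open>A\<close> stands for the algebra of operators \<open>\<pi>(\<A>)\<close>. On their domain
  \<open>spatial_tensor \<tau> A A\<close>, \<open>flip_map\<close> and \<open>middle_unit_map\<close> do not depend on the choice made
  by \<open>SOME\<close>: *-morphisms of C*-algebras are continuous, so they are determined by their values
  on elementary tensors.\<close>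

definition flip_map ::
  "('h::chilbert_space \<Rightarrow> 'h \<Rightarrow> 'h2::chilbert_space) \<Rightarrow> 'h op set \<Rightarrow> 'h2 op \<Rightarrow> 'h2 op" where
  "flip_map \<tau> A = (SOME \<Phi>.
     star_morphism (spatial_tensor \<tau> A A) (spatial_tensor \<tau> A A) \<Phi> \<and>
     (\<forall>a\<in>A. \<forall>b\<in>A. \<Phi> (op_tensor \<tau> a b) = op_tensor \<tau> b a))"

definition middle_unit_map ::
  "('h::chilbert_space \<Rightarrow> 'h \<Rightarrow> 'h2::chilbert_space) \<Rightarrow>
   ('h2 \<Rightarrow> 'h \<Rightarrow> 'h3::chilbert_space) \<Rightarrow> 'h op set \<Rightarrow> 'h2 op \<Rightarrow> 'h3 op" where
  "middle_unit_map \<tau> \<tau>l A = (SOME \<Phi>.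
     star_morphism (spatial_tensor \<tau> A A) (spatial_tensor \<tau>l (spatial_tensor \<tau> A A) A) \<Phi> \<and>
     (\<forall>a\<in>A. \<forall>b\<in>A. \<Phi> (op_tensor \<tau> a b) = op_tensor \<tau>l (op_tensor \<tau> a id_blinfun) b))"

definition P_delta ::
  "('h::chilbert_space \<Rightarrow> 'h \<Rightarrow> 'h2::chilbert_space) \<Rightarrow> 'h op set \<Rightarrow> 'h2 op" where
  "P_delta \<tau> A =
     (let M = commutant (commutant A)
      in proj_Sup (vN_tensor \<tau> M M) ((\<lambda>p. op_tensor \<tau> p p) ` minimal_projections M))"

definition H_delta ::
  "('h::chilbert_space \<Rightarrow> 'h \<Rightarrow> 'h2::chilbert_space) \<Rightarrow> 'h op set \<Rightarrow> 'h2 set" where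
  "H_delta \<tau> A = range (P_delta \<tau> A)"

definition quantum_metric ::
  "('h::chilbert_space \<Rightarrow> 'h \<Rightarrow> 'h2::chilbert_space) \<Rightarrow>
   ('h2 \<Rightarrow> 'h \<Rightarrow> 'h3::chilbert_space) \<Rightarrow> ('h \<Rightarrow> 'h2 \<Rightarrow> 'h3) \<Rightarrow>
   ('a::unital_cstar_algebra \<Rightarrow> 'h op) \<Rightarrow> 'h2 op \<Rightarrow> bool" where
  "quantum_metric \<tau> \<tau>l \<tau>r \<pi> \<rho> \<longleftrightarrow>
     (let A = range \<pi>;
          A2 = spatial_tensor \<tau> A A;
          A3 = spatial_tensor \<tau>l A2 A
      in \<rho> \<in> A2 \<and>
         positive_in A2 \<rho> \<and>
         \<rho> o\<^sub>L P_delta \<tau> A = 0 \<and> P_delta \<tau> A o\<^sub>L \<rho> = 0 \<and>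
         \<not> eigenvalue_on (orth_compl (H_delta \<tau> A)) \<rho> 0 \<and>
         flip_map \<tau> A \<rho> = \<rho> \<and>
         le_in A3 (middle_unit_map \<tau> \<tau>l A \<rho>)
           (op_tensor \<tau>l \<rho> id_blinfun + op_tensor \<tau>r id_blinfun \<rho>))"

end

theory Submission
  imports Defs
begin

text \<open>
  Every condition on a quantum metric survives the passage to \<open>\<rho>1 + r *\<^sub>R \<rho>2\<close> because it is linear
  or because positive elements of a C*-algebra form a convex cone.

  Annihilation by \<open>P_delta\<close> is linear. If the sum kills a vector \<open>x\<close>, then the two nonnegative
  numbers \<open>\<langle>x, \<rho>1 x\<rangle>\<close> and \<open>r \<langle>x, \<rho>2 x\<rangle>\<close> add up to zero, and since \<open>\<rho>1 = U* U\<close> this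
  forces \<open>U x = 0\<close>, hence \<open>\<rho>1 x = 0\<close> (\<open>kernel_add_positive\<close>); so \<open>0\<close> is not a new eigenvalue on
  the orthogonal complement of \<open>H_delta\<close>. The flip and the map inserting a unit in the
  middle are linear, so flip invariance is inherited, and the triangle inequality for the sum is
  the combination of the two given inequalities.

  Positivity is the existence of a root inside the algebra of operators concerned, so the cone
  property is the assertion that a sum \<open>U* U + V* V\<close> in a norm closed unital algebra of operators
  has a root there (\<open>positive_in_add\<close>). The usual norm criterion settles it: \<open>c - U* U\<close> has
  norm at most \<open>c\<close> as soon as \<open>c \<ge> \<parallel>U\<parallel>\<^sup>2\<close>, such bounds add up by the triangle inequality,
  and a selfadjoint element within distance \<open>1\<close> of the identity has a square root, obtained as the
  limit of an iteration (\<open>sqrt_id_minus_contraction\<close>).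

  The flip and the map inserting the unit are given by a choice among *-morphisms, and \<open>op_tensor\<close>
  and \<open>cadj\<close> by descriptions, so linearity rests on existence. Adjoints come from the Riesz
  representation theorem. An operator on a tensor product is built from its values on elementary
  tensors, boundedness being read off from Gram matrices (\<open>operator_of_gram\<close>); for \<open>S \<otimes> 1\<close> the
  required positivity is witnessed by a square root of \<open>\<parallel>S\<parallel>\<^sup>2 - S* S\<close> (\<open>defect_operator\<close>). Both
  morphisms are then conjugations: the flip by the unitary \<open>F\<close> exchanging the two tensor factors, and
  the other one is \<open>T \<mapsto> W (T \<otimes> 1) W\<close> with \<open>W = 1 \<otimes> F\<close>.
\<close>

section \<open>The inner product and the Riesz representation theorem\<close>

subclass (in chilbert_space) banach ..

lemma cinner_add_left: "cinner (x + y) z = cinner x z + cinner y z"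
  by (metis cinner_commute cinner_add_right complex_cnj_add)

lemma cinner_scaleC_left: "cinner (a *\<^sub>C x) y = cnj a * cinner x y"
  by (metis cinner_commute cinner_scaleC_right complex_cnj_mult)

lemma cinner_scaleR_left: "cinner (a *\<^sub>R x) y = a *\<^sub>R cinner x y"
  by (simp add: scaleR_scaleC cinner_scaleC_left scaleR_conv_of_real)

lemma cinner_scaleR_right: "cinner x (a *\<^sub>R y) = a *\<^sub>R cinner x y"
  by (simp add: scaleR_scaleC cinner_scaleC_right scaleR_conv_of_real)

lemma norm_add_power2:
  fixes x y :: "'h::chilbert_space"
  shows "(norm (x + y))\<^sup>2 = (norm x)\<^sup>2 + 2 * Re (cinner x y) + (norm y)\<^sup>2"
proof -
  have "complex_of_real ((norm (x + y))\<^sup>2) = cinner (x + y) (x + y)"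
    by (simp add: cinner_self)
  also have "\<dots> = cinner x x + cinner x y + cnj (cinner x y) + cinner y y"
    by (simp add: cinner_add_left cinner_add_right flip: cinner_commute[of y x])
  finally show ?thesis
    by (simp add: cinner_self complex_eq_iff)
qed

lemma norm_diff_power2:
  fixes x y :: "'h::chilbert_space"
  shows "(norm (x - y))\<^sup>2 = (norm x)\<^sup>2 - 2 * Re (cinner x y) + (norm y)\<^sup>2"
  using norm_add_power2[of x "- y"] cinner_scaleR_right[of x "-1" y] by simp

lemma cauchy_schwarz:
  fixes x y :: "'h::chilbert_space"
  shows "cmod (cinner x y) \<le> norm x * norm y"
proof (cases "x = 0")
  case True
  with cinner_scaleR_left[of 0 x y] show ?thesis by simp
next
  case False
  \<comment> \<open>Expand \<open>\<parallel>n y - \<langle>x, y\<rangle> x\<parallel>\<^sup>2\<close>: up to the factor \<open>n\<close>, the vector is the part of \<open>y\<close> orthogonal to \<open>x\<close>.\<close>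
  define n where "n = (norm x)\<^sup>2"
  define c where "c = cinner x y"
  have n: "n > 0" using False by (simp add: n_def)
  have *: "Re (c * cnj c) = (cmod c)\<^sup>2"
    by (simp add: complex_norm_square[symmetric] flip: of_real_power)
  have "0 \<le> (norm (n *\<^sub>R y - c *\<^sub>C x))\<^sup>2" by simp
  also have "\<dots> = n\<^sup>2 * (norm y)\<^sup>2 - 2 * (n * Re (c * cnj c)) + (cmod c)\<^sup>2 * n"
    by (simp add: norm_diff_power2 cinner_scaleR_left cinner_scaleC_right norm_scaleC
        power_mult_distrib n_def c_def flip: cinner_commute[of y x])
  also have "\<dots> = n * (n * (norm y)\<^sup>2 - (cmod c)\<^sup>2)"
    by (simp only: *) (simp add: power2_eq_square algebra_simps)
  finally have "(cmod c)\<^sup>2 \<le> (norm x * norm y)\<^sup>2"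
    using n by (simp add: zero_le_mult_iff n_def power_mult_distrib)
  then show ?thesis
    unfolding c_def by (rule power2_le_imp_le) simp
qed

lemma bounded_bilinear_cinner:
  "bounded_bilinear (cinner :: 'h::chilbert_space \<Rightarrow> 'h \<Rightarrow> complex)"
  by unfold_locales
    (use cauchy_schwarz in \<open>auto intro!: exI[of _ 1] simp: cinner_add_left cinner_add_right
        cinner_scaleR_left cinner_scaleR_right\<close>)

lemmas cinner_diff_left = bounded_bilinear.diff_left[OF bounded_bilinear_cinner]
  and cinner_diff_right = bounded_bilinear.diff_right[OF bounded_bilinear_cinner]
  and cinner_zero_left [simp] = bounded_bilinear.zero_left[OF bounded_bilinear_cinner]
  and cinner_zero_right [simp] = bounded_bilinear.zero_right[OF bounded_bilinear_cinner]
  and tendsto_cinner = bounded_bilinear.tendsto[OF bounded_bilinear_cinner]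

lemma cinner_left_eqI:
  fixes y z :: "'h::chilbert_space"
  assumes "\<And>x. cinner x y = cinner x z"
  shows "y = z"
proof -
  have "cinner (y - z) (y - z) = 0"
    using assms by (simp add: cinner_diff_right)
  then show ?thesis by (simp add: cinner_self)
qed

text \<open>The representing vector minimizes \<open>\<parallel>x\<parallel>\<^sup>2 - 2 Re (f x)\<close>. By the parallelogram law, minimizing
  sequences of this functional are Cauchy, and its derivative vanishes at the minimum.\<close>

lemma riesz_representation:
  fixes f :: "'h::chilbert_space \<Rightarrow> complex"
  assumes add: "\<And>x y. f (x + y) = f x + f y"
    and scale: "\<And>c x. f (c *\<^sub>C x) = c * f x"
    and bound: "\<And>x. cmod (f x) \<le> K * norm x"
  shows "\<exists>z. \<forall>x. f x = cinner z x"
proof -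
  define g where "g x = (norm x)\<^sup>2 - 2 * Re (f x)" for x
  define m where "m = (INF x. g x)"
  have bdd: "bdd_below (range g)"
  proof (rule bdd_belowI2)
    fix x :: 'h
    have "0 \<le> (norm x - K)\<^sup>2" by simp
    moreover have "Re (f x) \<le> K * norm x"
      using bound[of x] complex_Re_le_cmod[of "f x"] by linarith
    ultimately show "- K\<^sup>2 \<le> g x"
      by (simp add: g_def power2_eq_square algebra_simps)
  qed
  have m: "m \<le> g x" for x
    unfolding m_def by (rule cINF_lower[OF bdd]) simp
  have fR: "f (t *\<^sub>R x) = t * f x" for t x by (simp add: scaleR_scaleC scale)
  \<comment> \<open>Parallelogram law: the value at the midpoint of \<open>a\<close> and \<open>b\<close> is at least the infimum \<open>m\<close>.\<close>
  have par: "(norm (a - b))\<^sup>2 \<le> 2 * ((g a - m) + (g b - m))" for a b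
  proof -
    have mid: "g ((1/2) *\<^sub>R (a + b)) = (norm (a + b))\<^sup>2 / 4 - (Re (f a) + Re (f b))"
      by (simp only: g_def fR norm_scaleR add) (simp add: power_mult_distrib power_divide field_simps)
    show ?thesis
      using m[of "(1/2) *\<^sub>R (a + b)"] norm_add_power2[of a b] norm_diff_power2[of a b]
      unfolding mid unfolding g_def by argo
  qed
  have "\<exists>x. g x < m + 1 / real (Suc n)" for n
    using cINF_less_iff[OF _ bdd, of "m + 1 / real (Suc n)"] by (auto simp: m_def)
  then obtain X where X: "\<And>n. g (X n) < m + 1 / real (Suc n)" by metis
  have small: "norm (X i - X j) < e"
    if "e > 0" and N: "i \<ge> N" "j \<ge> N" "4 / e\<^sup>2 < real (Suc N)" for e i j N
  proof -
    have a: "g (X k) - m < 1 / real (Suc N)" if "k \<ge> N" for k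
    proof -
      have "1 / real (Suc k) \<le> 1 / real (Suc N)" using that by (simp add: field_simps)
      with X[of k] show ?thesis by linarith
    qed
    have "(norm (X i - X j))\<^sup>2 < 4 * (1 / real (Suc N))"
      using par[of "X i" "X j"] a[OF N(1)] a[OF N(2)] by argo
    also have "\<dots> < e\<^sup>2" using \<open>e > 0\<close> N(3) by (simp add: field_simps)
    finally show ?thesis using \<open>e > 0\<close> by (simp add: power2_less_imp_less)
  qed
  have "Cauchy X"
  proof (rule metric_CauchyI)
    fix e :: real assume e: "e > 0"
    obtain N where "4 / e\<^sup>2 < real N" using reals_Archimedean2 by blast
    then have "4 / e\<^sup>2 < real (Suc N)" by simp
    with small[OF e] show "\<exists>M. \<forall>i\<ge>M. \<forall>j\<ge>M. dist (X i) (X j) < e"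
      unfolding dist_norm by blast
  qed
  then obtain z where z: "X \<longlonglongrightarrow> z"
    using Cauchy_convergent convergent_def by blast
  have "bounded_linear f"
    by (rule bounded_linear_intro[where K = K])
      (use bound in \<open>simp_all add: add fR scaleR_conv_of_real mult.commute\<close>)
  then have "(\<lambda>n. g (X n)) \<longlonglongrightarrow> g z"
    unfolding g_def by (intro tendsto_intros z bounded_linear.tendsto[of f])
  moreover have "(\<lambda>n. m + 1 / real (Suc n)) \<longlonglongrightarrow> m + 0"
    by (intro tendsto_intros LIMSEQ_Suc[OF lim_1_over_n])
  ultimately have "g z \<le> m + 0"
    by (rule LIMSEQ_le) (use X in \<open>auto intro: less_imp_le\<close>)
  then have min: "g z \<le> g x" for x using m[of x] by linarith
  have re: "Re (f x) = Re (cinner z x)" for x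
  proof (rule ccontr)
    assume ne: "Re (f x) \<noteq> Re (cinner z x)"
    define d where "d = Re (f x) - Re (cinner z x)"
    have quad: "2 * t * d \<le> t\<^sup>2 * (norm x)\<^sup>2" for t
    proof -
      have "g (z + t *\<^sub>R x) = g z - 2 * t * d + t\<^sup>2 * (norm x)\<^sup>2"
        by (simp add: g_def norm_add_power2 cinner_scaleR_right add fR d_def
            power_mult_distrib algebra_simps)
      with min[of "z + t *\<^sub>R x"] show ?thesis by linarith
    qed
    have n: "(norm x)\<^sup>2 \<ge> 0" by simp
    \<comment> \<open>A step \<open>t = s d\<close> this small makes the linear term of \<open>quad\<close> dominate the quadratic one.\<close>
    define s where "s = 1 / ((norm x)\<^sup>2 + 1)"
    have s: "s > 0" "s * ((norm x)\<^sup>2 + 1) = 1" using n unfolding s_def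
      by (auto simp: add_nonneg_pos add_nonneg_eq_0_iff)
    have "2 * (s * d) * d \<le> (s * d)\<^sup>2 * (norm x)\<^sup>2" using quad .
    also have "\<dots> = s * d\<^sup>2 * (s * (norm x)\<^sup>2)" by (simp add: power2_eq_square)
    also have "\<dots> \<le> s * d\<^sup>2 * 1"
      using s by (intro mult_left_mono) (auto simp: algebra_simps)
    finally have "s * d\<^sup>2 \<le> 0" by (simp add: power2_eq_square ac_simps)
    with s ne show False by (simp add: mult_le_0_iff d_def)
  qed
  have "f x = cinner z x" for x
    \<comment> \<open>The imaginary part at \<open>x\<close> is minus the real part at \<open>\<i> x\<close>.\<close>
    using re[of x] re[of "\<i> *\<^sub>C x"]
    by (simp add: scale cinner_scaleC_right complex_eq_iff)
  then show ?thesis by blast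
qed

section \<open>Adjoints\<close>

lemma bounded_ops_scaleC: "T \<in> bounded_ops \<Longrightarrow> T (c *\<^sub>C x) = c *\<^sub>C T x"
  by (simp add: bounded_ops_def)

lemma scaleC_blinfun_apply: "blinfun_apply (c *\<^sub>C T) x = c *\<^sub>C blinfun_apply T x"
  by (simp add: scaleC_blinfun.rep_eq)

lemma bounded_linear_scaleC:
  "bounded_linear (\<lambda>x :: 'v::complex_normed_vector. c *\<^sub>C x)"
  by (rule bounded_linear_intro[where K = "cmod c"])
    (simp_all add: scaleC_add_right scaleR_scaleC scaleC_scaleC norm_scaleC mult.commute)

lemma csubspace_scaleR: "csubspace V \<Longrightarrow> x \<in> V \<Longrightarrow> r *\<^sub>R x \<in> V"
  by (simp add: scaleR_scaleC complex_vector.subspace_scale)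

lemma cmod_cinner_self: "cmod (cinner x x) = (norm x)\<^sup>2"
  by (simp only: cinner_self norm_of_real) simp

text \<open>The bound \<open>\<parallel>T* y\<parallel> \<le> \<parallel>T\<parallel> \<parallel>y\<parallel>\<close> for a vector \<open>z\<close> that behaves like \<open>T* y\<close>. It serves both to
  construct the adjoint and to estimate its norm.\<close>

lemma norm_le_if_cinner_eq:
  fixes T :: "'h::chilbert_space op"
  assumes "\<And>x. cinner (T x) y = cinner x z"
  shows "norm z \<le> norm T * norm y"
proof (cases "z = 0")
  case False
  have "norm z * norm z = cmod (cinner (T z) y)"
    by (simp add: assms cmod_cinner_self power2_eq_square)
  also have "\<dots> \<le> norm (T z) * norm y" by (rule cauchy_schwarz)
  also have "\<dots> \<le> (norm T * norm z) * norm y"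
    by (intro mult_right_mono norm_blinfun) simp
  finally have "norm z * norm z \<le> norm z * (norm T * norm y)" by (simp add: ac_simps)
  with False show ?thesis by simp
qed simp

lemma adjoint_exists:
  fixes T :: "'h::chilbert_space op"
  assumes T: "T \<in> bounded_ops"
  shows "\<exists>S :: 'h op. \<forall>x y. cinner (T x) y = cinner x (S y)"
proof -
  have "\<exists>z. \<forall>x. cinner y (T x) = cinner z x" for y
  proof (rule riesz_representation)
    show "cmod (cinner y (T x)) \<le> (norm y * norm T) * norm x" for x
      using cauchy_schwarz[of y "T x"] mult_left_mono[OF norm_blinfun[of T x], of "norm y"]
      by (simp add: ac_simps)
  qed (simp_all add: blinfun.add_right cinner_add_right bounded_ops_scaleC[OF T]
      cinner_scaleC_right)
  then obtain S where "\<And>y x. cinner y (T x) = cinner (S y) x" by metis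
  then have S: "cinner (T x) y = cinner x (S y)" for x y by (metis cinner_commute)
  have "bounded_linear S"
  proof (rule bounded_linear_intro)
    show "S (x + y) = S x + S y" for x y
      by (rule cinner_left_eqI) (simp add: cinner_add_right flip: S)
    show "S (r *\<^sub>R x) = r *\<^sub>R S x" for r x
      by (rule cinner_left_eqI) (simp add: cinner_scaleR_right flip: S)
    show "norm (S y) \<le> norm y * norm T" for y
      using norm_le_if_cinner_eq[of T y "S y"] S by (simp add: mult.commute)
  qed
  then show ?thesis
    using S by (intro exI[of _ "Blinfun S"]) (simp add: bounded_linear_Blinfun_apply)
qed

lemma cadj_eqI:
  fixes S T :: "'h::chilbert_space op"
  assumes "\<And>x y. cinner (T x) y = cinner x (S y)"
  shows "cadj T = S"
  unfolding cadj_def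
proof (rule the_equality)
  fix S' :: "'h op"
  assume S': "\<forall>x y. cinner (T x) y = cinner x (S' y)"
  show "S' = S"
    by (intro blinfun_eqI cinner_left_eqI) (metis S' assms)
qed (use assms in simp)

lemma cinner_cadj_right: "T \<in> bounded_ops \<Longrightarrow> cinner x (cadj T y) = cinner (T x) y"
  using adjoint_exists[of T] cadj_eqI[of T] by metis

lemma cinner_cadj_left: "T \<in> bounded_ops \<Longrightarrow> cinner (cadj T x) y = cinner x (T y)"
  by (metis cinner_cadj_right cinner_commute)

lemma cadj_in_bounded_ops:
  assumes T: "T \<in> bounded_ops"
  shows "cadj T \<in> bounded_ops"
proof -
  have "cadj T (c *\<^sub>C y) = c *\<^sub>C cadj T y" for c y
    by (rule cinner_left_eqI) (simp add: cinner_cadj_right[OF T] cinner_scaleC_right)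
  then show ?thesis by (simp add: bounded_ops_def)
qed

lemma cadj_scaleR: "T \<in> bounded_ops \<Longrightarrow> cadj (r *\<^sub>R T) = r *\<^sub>R cadj T"
  by (rule cadj_eqI)
    (simp add: blinfun.scaleR_left cinner_scaleR_left cinner_scaleR_right cinner_cadj_right)

lemma cadj_compose:
  "S \<in> bounded_ops \<Longrightarrow> T \<in> bounded_ops \<Longrightarrow> cadj (S o\<^sub>L T) = cadj T o\<^sub>L cadj S"
  by (rule cadj_eqI) (simp add: cinner_cadj_right)

section \<open>Closed algebras of operators and their positive elements\<close>

lemma csubspace_closure:
  fixes V :: "'v::complex_normed_vector set"
  assumes V: "csubspace V"
  shows "csubspace (closure V)"
  unfolding complex_vector.subspace_def
proof (intro conjI ballI allI)
  show "0 \<in> closure V"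
    using complex_vector.subspace_0[OF V] closure_subset by blast
next
  fix x y assume "x \<in> closure V" "y \<in> closure V"
  then obtain f g where "\<And>n. f n \<in> V" "f \<longlonglongrightarrow> x" "\<And>n. g n \<in> V" "g \<longlonglongrightarrow> y"
    unfolding closure_sequential by blast
  then show "x + y \<in> closure V"
    unfolding closure_sequential
    by (intro exI[of _ "\<lambda>n. f n + g n"]) (simp add: complex_vector.subspace_add[OF V] tendsto_add)
next
  fix c x assume "x \<in> closure V"
  then obtain f where "\<And>n. f n \<in> V" "f \<longlonglongrightarrow> x"
    unfolding closure_sequential by blast
  then show "c *\<^sub>C x \<in> closure V"
    unfolding closure_sequential
    by (intro exI[of _ "\<lambda>n. c *\<^sub>C f n"])
      (simp add: complex_vector.subspace_scale[OF V]
        bounded_linear.tendsto[OF bounded_linear_scaleC])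
qed

lemma closure_cspan_minimal:
  assumes "D \<subseteq> E" "csubspace E" "closed E"
  shows "closure (cspan D) \<subseteq> E"
  using assms by (intro closure_minimal complex_vector.span_minimal)

lemma csubspace_bounded_ops: "csubspace (bounded_ops :: 'h::chilbert_space op set)"
  unfolding complex_vector.subspace_def bounded_ops_def
  by (auto simp: blinfun.add_left scaleC_blinfun_apply scaleC_add_right scaleC_scaleC
      mult.commute)

lemma closed_bounded_ops: "closed (bounded_ops :: 'h::chilbert_space op set)"
proof -
  have "closed {T :: 'h op. T (c *\<^sub>C x) = c *\<^sub>C T x}" for c x
    by (intro closed_Collect_eq continuous_intros
        bounded_linear.continuous_on[OF bounded_linear_scaleC])
  then have "closed (\<Inter>c. \<Inter>x. {T :: 'h op. T (c *\<^sub>C x) = c *\<^sub>C T x})"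
    by (intro closed_INT ballI)
  also have "(\<Inter>c. \<Inter>x. {T :: 'h op. T (c *\<^sub>C x) = c *\<^sub>C T x}) = bounded_ops"
    by (auto simp: bounded_ops_def)
  finally show ?thesis .
qed

text \<open>Only products and the unit have to be controlled on generators: linear combinations and limits
  are supplied by \<open>closure (cspan D)\<close>.\<close>

definition operator_monoid :: "'h::chilbert_space op set \<Rightarrow> bool" where
  "operator_monoid B \<longleftrightarrow>
     B \<subseteq> bounded_ops \<and> id_blinfun \<in> B \<and> (\<forall>S\<in>B. \<forall>T\<in>B. S o\<^sub>L T \<in> B)"

definition operator_algebra :: "'h::chilbert_space op set \<Rightarrow> bool" where
  "operator_algebra B \<longleftrightarrow> operator_monoid B \<and> csubspace B \<and> closed B"

lemma operator_monoidD:
  assumes "operator_monoid B"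
  shows "T \<in> B \<Longrightarrow> T \<in> bounded_ops" "id_blinfun \<in> B"
    "S \<in> B \<Longrightarrow> T \<in> B \<Longrightarrow> S o\<^sub>L T \<in> B"
  using assms by (auto simp: operator_monoid_def)

lemma operator_algebraD:
  assumes "operator_algebra B"
  shows "operator_monoid B" "csubspace B" "closed B"
  using assms by (auto simp: operator_algebra_def)

lemma operator_monoid_bounded_ops: "operator_monoid bounded_ops"
  by (auto simp: operator_monoid_def bounded_ops_def)

lemma operator_algebra_bounded_ops: "operator_algebra bounded_ops"
  by (simp add: operator_algebra_def operator_monoid_bounded_ops csubspace_bounded_ops
      closed_bounded_ops)

lemmas compose_in_bounded_ops = operator_monoidD(3)[OF operator_monoid_bounded_ops]
  and id_in_bounded_ops = operator_monoidD(2)[OF operator_monoid_bounded_ops]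

lemmas blinfun_compose_diff_left = bounded_bilinear.diff_left[OF bounded_bilinear_blinfun_compose]
  and blinfun_compose_diff_right = bounded_bilinear.diff_right[OF bounded_bilinear_blinfun_compose]
  and blinfun_compose_add_left = bounded_bilinear.add_left[OF bounded_bilinear_blinfun_compose]
  and blinfun_compose_add_right = bounded_bilinear.add_right[OF bounded_bilinear_blinfun_compose]
  and blinfun_compose_scaleR_left = bounded_bilinear.scaleR_left[OF bounded_bilinear_blinfun_compose]
  and blinfun_compose_scaleR_right = bounded_bilinear.scaleR_right[OF bounded_bilinear_blinfun_compose]
  and tendsto_blinfun_compose = bounded_bilinear.tendsto[OF bounded_bilinear_blinfun_compose]

text \<open>With \<open>Z = 1 - R\<close> the equation \<open>R\<^sup>2 = 1 - X\<close> becomes \<open>Z = (X + Z\<^sup>2) / 2\<close>, which is solved by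
  iteration from \<open>0\<close>. The iterates are dominated, in norm and in the norms of their increments, by
  those of the scalar equation with \<open>X\<close> replaced by \<open>1\<close>. The scalar iterates increase and stay
  below \<open>1\<close>, hence converge, and this gives convergence in norm even when \<open>\<parallel>X\<parallel> = 1\<close>.\<close>

lemma sqrt_id_minus_contraction:
  fixes X :: "'h::chilbert_space op"
  assumes B: "operator_algebra B" and X: "X \<in> B" and norm_X: "norm X \<le> 1"
    and selfadjoint: "\<And>x y. cinner (X x) y = cinner x (X y)"
  shows "\<exists>R\<in>B. R o\<^sub>L R = id_blinfun - X \<and> (\<forall>x y. cinner (R x) y = cinner x (R y))"
proof -
  note B_closed = operator_monoidD[OF operator_algebraD(1)[OF B]]
  note B_sub = operator_algebraD(2)[OF B]
  define Y where "Y n = ((\<lambda>Y. (1/2) *\<^sub>R (X + (Y o\<^sub>L Y))) ^^ n) 0" for n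
  define y where "y n = ((\<lambda>y :: real. (1 + y\<^sup>2) / 2) ^^ n) 0" for n
  have Y0: "Y 0 = 0" and YS: "Y (Suc n) = (1/2) *\<^sub>R (X + (Y n o\<^sub>L Y n))" for n
    by (simp_all add: Y_def)
  have y0: "y 0 = 0" and yS: "y (Suc n) = (1 + (y n)\<^sup>2) / 2" for n
    by (simp_all add: y_def)
  have y_bounds: "0 \<le> y n \<and> y n \<le> 1" for n
    by (induction n) (simp_all add: y0 yS power_le_one)
  have norm_Y: "norm (Y n) \<le> y n" for n
  proof (induction n)
    case (Suc n)
    have "norm (Y n o\<^sub>L Y n) \<le> norm (Y n) * norm (Y n)"
      by (rule norm_blinfun_compose)
    also have "\<dots> \<le> (y n)\<^sup>2"
      unfolding power2_eq_square by (rule mult_mono') (use Suc in simp_all)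
    finally have "norm (X + (Y n o\<^sub>L Y n)) \<le> 1 + (y n)\<^sup>2"
      by (intro order_trans[OF norm_triangle_ineq] add_mono norm_X)
    then show ?case by (simp add: YS yS del: scaleR_add_right)
  qed (simp add: Y0 y0)
  have step: "norm (Y (Suc n) - Y n) \<le> y (Suc n) - y n" for n
  proof (induction n)
    case 0
    then show ?case using norm_X by (simp add: Y0 YS y0 yS)
  next
    case (Suc n)
    let ?D = "Y (Suc n) - Y n"
    \<comment> \<open>The noncommutative identity \<open>A\<^sup>2 - B\<^sup>2 = A (A - B) + (A - B) B\<close>.\<close>
    have "Y (Suc (Suc n)) - Y (Suc n) =
        (1/2) *\<^sub>R ((X + (Y (Suc n) o\<^sub>L Y (Suc n))) - (X + (Y n o\<^sub>L Y n)))"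
      by (simp only: scaleR_diff_right flip: YS)
    also have "(X + (Y (Suc n) o\<^sub>L Y (Suc n))) - (X + (Y n o\<^sub>L Y n)) =
        (Y (Suc n) o\<^sub>L ?D) + (?D o\<^sub>L Y n)"
      by (simp add: blinfun_compose_diff_left blinfun_compose_diff_right)
    finally have *: "Y (Suc (Suc n)) - Y (Suc n) =
        (1/2) *\<^sub>R ((Y (Suc n) o\<^sub>L ?D) + (?D o\<^sub>L Y n))" .
    have "norm (Y (Suc (Suc n)) - Y (Suc n))
        \<le> (1/2) * (y (Suc n) * (y (Suc n) - y n) + (y (Suc n) - y n) * y n)"
    proof -
      have "norm (Y (Suc n) o\<^sub>L ?D) \<le> y (Suc n) * (y (Suc n) - y n)"
        by (rule order_trans[OF norm_blinfun_compose mult_mono'[OF norm_Y Suc]]) simp_all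
      moreover have "norm (?D o\<^sub>L Y n) \<le> (y (Suc n) - y n) * y n"
        by (rule order_trans[OF norm_blinfun_compose mult_mono'[OF Suc norm_Y]]) simp_all
      ultimately show ?thesis
        using norm_triangle_ineq[of "Y (Suc n) o\<^sub>L ?D" "?D o\<^sub>L Y n"]
        unfolding * norm_scaleR by simp
    qed
    also have "\<dots> = (1 + (y (Suc n))\<^sup>2) / 2 - (1 + (y n)\<^sup>2) / 2"
      by (simp add: power2_eq_square field_simps)
    also have "\<dots> = y (Suc (Suc n)) - y (Suc n)" by (simp only: yS)
    finally show ?case .
  qed
  have "incseq y"
  proof (rule incseq_SucI)
    show "y n \<le> y (Suc n)" for n
      using zero_le_power2[of "1 - y n"] by (simp add: yS power2_eq_square algebra_simps)
  qed
  then obtain l where "y \<longlonglongrightarrow> l"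
    using incseq_convergent[of y 1] y_bounds by blast
  then have "summable (\<lambda>n. y (Suc n) - y n)" by (rule telescope_summable)
  \<comment> \<open>The increments of \<open>y\<close> are a summable majorant for those of \<open>Y\<close>.\<close>
  then have "summable (\<lambda>n. Y (Suc n) - Y n)"
    by (rule summable_comparison_test') (rule step)
  then obtain Z where Z: "Y \<longlonglongrightarrow> Z"
    using summable_LIMSEQ[of "\<lambda>n. Y (Suc n) - Y n"] by (auto simp: sum_lessThan_telescope Y0)
  have "Y n \<in> B" for n
    by (induction n)
      (simp_all add: Y0 YS X B_closed csubspace_scaleR[OF B_sub]
        complex_vector.subspace_add[OF B_sub] complex_vector.subspace_0[OF B_sub]
        del: scaleR_add_right)
  then have ZB: "Z \<in> B"
    using closed_sequentially[OF operator_algebraD(3)[OF B]] Z by blast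
  have Y_selfadjoint: "cinner (Y n x) z = cinner x (Y n z)" for n x z
    by (induction n arbitrary: x z)
      (simp_all add: Y0 YS blinfun.add_left blinfun.scaleR_left cinner_add_left cinner_add_right
        cinner_scaleR_left cinner_scaleR_right selfadjoint del: scaleR_add_right)
  have Z_selfadjoint: "cinner (Z x) z = cinner x (Z z)" for x z
  proof (rule LIMSEQ_unique)
    show "(\<lambda>n. cinner (Y n x) z) \<longlonglongrightarrow> cinner (Z x) z"
      by (intro tendsto_cinner tendsto_intros Z)
    show "(\<lambda>n. cinner (Y n x) z) \<longlonglongrightarrow> cinner x (Z z)"
      unfolding Y_selfadjoint by (intro tendsto_cinner tendsto_intros Z)
  qed
  have "(\<lambda>n. Y (Suc n)) \<longlonglongrightarrow> (1/2) *\<^sub>R (X + (Z o\<^sub>L Z))"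
    unfolding YS by (intro tendsto_intros tendsto_blinfun_compose Z)
  then have "Z = (1/2) *\<^sub>R (X + (Z o\<^sub>L Z))"
    by (rule LIMSEQ_unique[OF LIMSEQ_Suc[OF Z]])
  then have "2 *\<^sub>R Z = 2 *\<^sub>R ((1/2) *\<^sub>R (X + (Z o\<^sub>L Z)))"
    by (rule arg_cong)
  also have "\<dots> = X + (Z o\<^sub>L Z)" by (simp del: scaleR_add_right)
  finally have "2 *\<^sub>R Z = X + (Z o\<^sub>L Z)" .
  then have XZ: "Z o\<^sub>L Z = Z + Z - X" by (simp add: scaleR_2)
  show ?thesis
  proof (intro bexI[of _ "id_blinfun - Z"] conjI allI)
    show "(id_blinfun - Z) o\<^sub>L (id_blinfun - Z) = id_blinfun - X"
      by (intro blinfun_eqI) (simp add: blinfun_compose_diff_left blinfun_compose_diff_right XZ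
          blinfun.diff_left blinfun.add_left)
    show "id_blinfun - Z \<in> B"
      by (rule complex_vector.subspace_diff[OF B_sub B_closed(2) ZB])
    show "cinner ((id_blinfun - Z) x) z = cinner x ((id_blinfun - Z) z)" for x z
      by (simp add: blinfun.diff_left cinner_diff_left cinner_diff_right Z_selfadjoint)
  qed
qed

text \<open>Expanding the square, \<open>\<parallel>c x - S* S x\<parallel>\<^sup>2 = c\<^sup>2 \<parallel>x\<parallel>\<^sup>2 - 2 c \<parallel>S x\<parallel>\<^sup>2 + \<parallel>S* S x\<parallel>\<^sup>2\<close>, and the last
  term is at most \<open>c \<parallel>S x\<parallel>\<^sup>2\<close>.\<close>

lemma norm_scaled_id_minus_cadj_compose:
  fixes S :: "'h::chilbert_space op"
  assumes S: "S \<in> bounded_ops" and c: "(norm S)\<^sup>2 \<le> c"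
  shows "norm (c *\<^sub>R id_blinfun - (cadj S o\<^sub>L S)) \<le> c"
proof (rule norm_blinfun_bound)
  show c0: "0 \<le> c" using c zero_le_power2[of "norm S"] by linarith
  fix x
  have adj: "(norm (cadj S y))\<^sup>2 \<le> c * (norm y)\<^sup>2" for y
  proof -
    have "(norm (cadj S y))\<^sup>2 \<le> (norm S * norm y)\<^sup>2"
      by (intro power_mono norm_le_if_cinner_eq) (simp_all add: cinner_cadj_right S)
    also have "\<dots> \<le> c * (norm y)\<^sup>2"
      unfolding power_mult_distrib by (intro mult_right_mono c) simp
    finally show ?thesis .
  qed
  have "(norm (c *\<^sub>R x - cadj S (S x)))\<^sup>2 =
      c\<^sup>2 * (norm x)\<^sup>2 - 2 * (c * (norm (S x))\<^sup>2) + (norm (cadj S (S x)))\<^sup>2"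
    by (simp add: norm_diff_power2 cinner_scaleR_left cinner_cadj_right[OF S] cinner_self
        power_mult_distrib blinfun.scaleR_right del: of_real_power)
  also have "\<dots> \<le> c\<^sup>2 * (norm x)\<^sup>2 - c * (norm (S x))\<^sup>2"
    using adj[of "S x"] by simp
  also have "\<dots> \<le> (c * norm x)\<^sup>2" using c0 by (simp add: power_mult_distrib)
  finally have "norm (c *\<^sub>R x - cadj S (S x)) \<le> c * norm x"
    by (rule power2_le_imp_le) (simp add: c0)
  then show "norm (blinfun_apply (c *\<^sub>R id_blinfun - (cadj S o\<^sub>L S)) x) \<le> c * norm x"
    by (simp add: blinfun.diff_left blinfun.scaleR_left)
qed

text \<open>The summands lie within \<open>a\<close> of \<open>a\<close> and within \<open>b\<close> of \<open>b\<close>, so after division by \<open>a + b\<close> their sum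
  lies within \<open>1\<close> of the identity and has a selfadjoint square root in the algebra.\<close>

lemma positive_in_add:
  fixes S T :: "'h::chilbert_space op"
  assumes B: "operator_algebra B" and mem: "S \<in> B" "T \<in> B"
    and pos: "positive_in B S" "positive_in B T"
  shows "positive_in B (S + T)"
proof -
  note B_closed = operator_monoidD[OF operator_algebraD(1)[OF B]]
  note B_sub = operator_algebraD(2)[OF B]
  obtain U V where U: "U \<in> B" "S = cadj U o\<^sub>L U" and V: "V \<in> B" "T = cadj V o\<^sub>L V"
    using pos unfolding positive_in_def by blast
  note UV = B_closed(1)[OF U(1)] B_closed(1)[OF V(1)]
  \<comment> \<open>The summand \<open>1\<close> keeps \<open>a + b\<close> invertible when both operators vanish.\<close>
  define a where "a = (norm U)\<^sup>2 + 1"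
  define b where "b = (norm V)\<^sup>2 + 1"
  have "a > 0" "b > 0" by (simp_all add: a_def b_def add_nonneg_pos)
  then have ab: "a + b > 0" by simp
  let ?X = "id_blinfun - (1 / (a + b)) *\<^sub>R (S + T)"
  have "\<exists>R\<in>B. R o\<^sub>L R = id_blinfun - ?X \<and> (\<forall>x y. cinner (R x) y = cinner x (R y))"
  proof (rule sqrt_id_minus_contraction[OF B])
    show "?X \<in> B"
      by (intro complex_vector.subspace_diff[OF B_sub] csubspace_scaleR[OF B_sub]
          complex_vector.subspace_add[OF B_sub] mem B_closed(2))
    have "norm ((a *\<^sub>R id_blinfun - S) + (b *\<^sub>R id_blinfun - T)) \<le> a + b"
      unfolding U(2) V(2)
      by (intro norm_triangle_mono norm_scaled_id_minus_cadj_compose UV)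
        (simp_all add: a_def b_def)
    also have "(a *\<^sub>R id_blinfun - S) + (b *\<^sub>R id_blinfun - T) = (a + b) *\<^sub>R ?X"
      using ab by (simp add: scaleR_diff_right scaleR_add_left)
    finally show "norm ?X \<le> 1" using ab by simp
    show "cinner (?X x) y = cinner x (?X y)" for x y
      by (simp add: U(2) V(2) blinfun.diff_left blinfun.add_left blinfun.scaleR_left cinner_diff_left
          cinner_diff_right cinner_add_left cinner_add_right cinner_scaleR_left
          cinner_scaleR_right cinner_cadj_right cinner_cadj_left UV)
  qed
  then obtain R where R: "R \<in> B" "R o\<^sub>L R = (1 / (a + b)) *\<^sub>R (S + T)"
    and "\<And>x y. cinner (R x) y = cinner x (R y)" by auto
  then have "cadj R = R" by (intro cadj_eqI)
  then have "cadj (sqrt (a + b) *\<^sub>R R) o\<^sub>L (sqrt (a + b) *\<^sub>R R) = S + T"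
    using ab R by (simp add: cadj_scaleR B_closed(1) blinfun_compose_scaleR_left
        blinfun_compose_scaleR_right)
  then show ?thesis
    unfolding positive_in_def
    using csubspace_scaleR[OF B_sub R(1)] by metis
qed

lemma positive_in_scaleR:
  assumes B: "operator_algebra B" and "positive_in B T" and "r \<ge> 0"
  shows "positive_in B (r *\<^sub>R T)"
proof -
  obtain S where S: "S \<in> B" "T = cadj S o\<^sub>L S"
    using assms unfolding positive_in_def by blast
  then have "r *\<^sub>R T = cadj (sqrt r *\<^sub>R S) o\<^sub>L (sqrt r *\<^sub>R S)"
    using \<open>r \<ge> 0\<close> operator_monoidD(1)[OF operator_algebraD(1)[OF B]]
    by (simp add: cadj_scaleR blinfun_compose_scaleR_left blinfun_compose_scaleR_right)
  then show ?thesis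
    unfolding positive_in_def
    using csubspace_scaleR[OF operator_algebraD(2)[OF B] S(1)] by metis
qed

text \<open>\<open>R\<close> is the square root of \<open>\<parallel>T\<parallel>\<^sup>2 - T* T\<close>. The identity exhibits the difference of the Gram
  matrices of \<open>\<parallel>T\<parallel> x\<^sub>i\<close> and \<open>T x\<^sub>i\<close> as another Gram matrix, and this property, unlike mere
  positivity, passes directly to tensor products.\<close>

lemma defect_operator:
  fixes T :: "'h::chilbert_space op"
  assumes T: "T \<in> bounded_ops"
  shows "\<exists>R :: 'h op. \<forall>x y. (norm T)\<^sup>2 *\<^sub>R cinner x y = cinner (T x) (T y) + cinner (R x) (R y)"
proof (cases "T = 0")
  case True
  then show ?thesis by (intro exI[of _ 0]) simp
next
  case False
  define c where "c = (norm T)\<^sup>2"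
  have c: "c > 0" using False by (simp add: c_def)
  have adj: "norm (cadj T) \<le> norm T"
    by (intro norm_blinfun_bound norm_le_if_cinner_eq) (simp_all add: cinner_cadj_right T)
  let ?X = "(1 / c) *\<^sub>R (cadj T o\<^sub>L T)"
  have "\<exists>R\<in>bounded_ops. R o\<^sub>L R = id_blinfun - ?X \<and> (\<forall>x y. cinner (R x) y = cinner x (R y))"
  proof (rule sqrt_id_minus_contraction[OF operator_algebra_bounded_ops])
    show "?X \<in> bounded_ops"
      by (intro csubspace_scaleR csubspace_bounded_ops compose_in_bounded_ops
          cadj_in_bounded_ops T)
    have "norm (cadj T o\<^sub>L T) \<le> c"
      unfolding c_def power2_eq_square
      by (rule order_trans[OF norm_blinfun_compose]) (use adj in \<open>simp add: mult_right_mono\<close>)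
    then show "norm ?X \<le> 1" using c by simp
    show "cinner (?X x) y = cinner x (?X y)" for x y
      by (simp add: blinfun.scaleR_left cinner_scaleR_left cinner_scaleR_right
          cinner_cadj_right cinner_cadj_left T)
  qed
  then obtain R where R: "R o\<^sub>L R = id_blinfun - ?X"
    "\<And>x y. cinner (R x) y = cinner x (R y)" by auto
  have key: "cinner ((norm T *\<^sub>R R) x) ((norm T *\<^sub>R R) y) =
      c *\<^sub>R cinner x y - cinner (T x) (T y)" for x y
  proof -
    have "cinner ((norm T *\<^sub>R R) x) ((norm T *\<^sub>R R) y) = c *\<^sub>R cinner x ((R o\<^sub>L R) y)"
      by (simp add: blinfun.scaleR_left cinner_scaleR_left cinner_scaleR_right R(2) c_def
          power2_eq_square)
    also have "\<dots> = c *\<^sub>R (cinner x y - (1 / c) *\<^sub>R cinner (T x) (T y))"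
      unfolding R(1)
      by (simp add: blinfun.diff_left blinfun.scaleR_left cinner_diff_right cinner_scaleR_right
          cinner_cadj_right T)
    also have "\<dots> = c *\<^sub>R cinner x y - cinner (T x) (T y)"
      using c by (simp add: scaleR_diff_right)
    finally show ?thesis .
  qed
  show ?thesis
  proof (intro exI allI)
    show "(norm T)\<^sup>2 *\<^sub>R cinner x y =
        cinner (T x) (T y) + cinner ((norm T *\<^sub>R R) x) ((norm T *\<^sub>R R) y)" for x y
      unfolding key c_def by simp
  qed
qed

lemma id_blinfun_compose [simp]: "id_blinfun o\<^sub>L T = T" "T o\<^sub>L id_blinfun = T"
  by (auto intro: blinfun_eqI)

section \<open>Operators with prescribed values on a total set\<close>

text \<open>The graph of a complex linear operator is a complex subspace of a product, and spans and
  closures of graphs are formed there.\<close>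

instantiation prod :: (complex_normed_vector, complex_normed_vector) complex_normed_vector
begin

definition scaleC_prod :: "complex \<Rightarrow> 'a \<times> 'b \<Rightarrow> 'a \<times> 'b" where
  "scaleC_prod c p = (c *\<^sub>C fst p, c *\<^sub>C snd p)"

instance
proof
  fix c :: complex and p :: "'a \<times> 'b"
  show "norm (c *\<^sub>C p) = cmod c * norm p"
    by (simp add: norm_prod_def scaleC_prod_def norm_scaleC power_mult_distrib real_sqrt_mult
        flip: distrib_left)
qed (simp_all add: scaleC_prod_def scaleR_prod_def scaleR_scaleC scaleC_add_right
    scaleC_add_left scaleC_scaleC scaleC_one prod_eq_iff)

end

text \<open>The bound survives in the closure of \<open>G\<close> and makes it single valued; by completeness the closure
  is defined everywhere, so it is the graph of the operator.\<close>

lemma operator_of_graph: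
  fixes G :: "('l::complex_normed_vector \<times> 'm::{complex_normed_vector, banach}) set"
  assumes G: "csubspace G" and bound: "\<And>a b. (a, b) \<in> G \<Longrightarrow> norm b \<le> K * norm a"
    and dense: "closure (fst ` G) = UNIV" and K: "K \<ge> 0"
  shows "\<exists>R :: 'l \<Rightarrow>\<^sub>L 'm. (\<forall>c x. blinfun_apply R (c *\<^sub>C x) = c *\<^sub>C R x) \<and>
    (\<forall>(a, b)\<in>G. blinfun_apply R a = b) \<and> norm R \<le> K"
proof -
  let ?H = "closure G"
  have H: "csubspace ?H" by (rule csubspace_closure[OF G])
  have "closed {p :: 'l \<times> 'm. norm (snd p) \<le> K * norm (fst p)}"
    by (intro closed_Collect_le continuous_intros)
  then have "?H \<subseteq> {p. norm (snd p) \<le> K * norm (fst p)}"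
    using bound by (intro closure_minimal) auto
  then have H_bound: "norm b \<le> K * norm a" if "(a, b) \<in> ?H" for a b
    using that by auto
  have unique: "b = b'" if "(a, b) \<in> ?H" "(a, b') \<in> ?H" for a b b'
    using H_bound[of 0 "b - b'"] complex_vector.subspace_diff[OF H that] by simp
  have "\<exists>b. (a, b) \<in> ?H" for a
  proof -
    have "a \<in> closure (fst ` G)" using dense by simp
    then obtain s where s: "\<And>n. s n \<in> fst ` G" "s \<longlonglongrightarrow> a"
      unfolding closure_sequential by blast
    have "\<forall>n. \<exists>b. (s n, b) \<in> G" using s(1) by force
    then obtain t where t: "\<And>n. (s n, t n) \<in> G" by metis
    have lip: "norm (t i - t j) \<le> K * norm (s i - s j)" for i j
      using bound[of "s i - s j" "t i - t j"] complex_vector.subspace_diff[OF G t[of i] t[of j]]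
      by simp
    have "Cauchy t"
    proof (rule metric_CauchyI)
      fix e :: real assume "e > 0"
      \<comment> \<open>Dividing by \<open>K + 1\<close> instead of \<open>K\<close> covers \<open>K = 0\<close>.\<close>
      then have "e / (K + 1) > 0" using K by simp
      then obtain N where N: "\<And>i j. i \<ge> N \<Longrightarrow> j \<ge> N \<Longrightarrow> norm (s i - s j) < e / (K + 1)"
        using LIMSEQ_imp_Cauchy[OF s(2)] unfolding Cauchy_def dist_norm by blast
      have "norm (t i - t j) < e" if "i \<ge> N" "j \<ge> N" for i j
      proof -
        have "norm (t i - t j) \<le> (K + 1) * norm (s i - s j)"
          using lip[of i j] by (simp add: distrib_right add_increasing2)
        also have "\<dots> < e" using N[OF that] K by (simp add: field_simps)
        finally show ?thesis .
      qed
      then show "\<exists>M. \<forall>i\<ge>M. \<forall>j\<ge>M. dist (t i) (t j) < e"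
        unfolding dist_norm by blast
    qed
    then obtain b where "t \<longlonglongrightarrow> b"
      using Cauchy_convergent convergent_def by blast
    then have "(\<lambda>n. (s n, t n)) \<longlonglongrightarrow> (a, b)" by (intro tendsto_Pair s(2))
    then have "(a, b) \<in> ?H" 
      unfolding closure_sequential using t by (intro exI[of _ "\<lambda>n. (s n, t n)"]) simp
    then show ?thesis by blast
  qed
  then obtain R where R: "\<And>a. (a, R a) \<in> ?H" by metis
  have R_add: "R (x + y) = R x + R y" for x y
    using unique[OF R] complex_vector.subspace_add[OF H R[of x] R[of y]] by simp
  have R_scaleC: "R (c *\<^sub>C x) = c *\<^sub>C R x" for c x
    using unique[OF R] complex_vector.subspace_scale[OF H R[of x], of c]
    by (simp add: scaleC_prod_def)
  have "bounded_linear R"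
    by (rule bounded_linear_intro[where K = K])
      (simp_all add: R_add R_scaleC scaleR_scaleC H_bound[OF R] mult.commute)
  then have app: "blinfun_apply (Blinfun R) = R" by (rule bounded_linear_Blinfun_apply)
  show ?thesis
  proof (intro exI[of _ "Blinfun R"] conjI allI ballI)
    show "norm (Blinfun R) \<le> K"
      by (intro norm_blinfun_bound K) (simp add: app H_bound[OF R])
    show "case p of (a, b) \<Rightarrow> blinfun_apply (Blinfun R) a = b" if "p \<in> G" for p
      using unique[OF R] that closure_subset[of G] by (auto simp: app)
  qed (simp add: app R_scaleC)
qed

text \<open>With \<open>h\<close> the identity this applies to linear, with \<open>h = cnj\<close> to antilinear functionals, that is,
  to either argument of the inner product.\<close>

lemma csubspace_equalizer:
  fixes f g :: "'v::complex_normed_vector \<Rightarrow> complex"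
  assumes "f 0 = g 0" "\<And>x y. f (x + y) = f x + f y" "\<And>x y. g (x + y) = g x + g y"
    "\<And>c x. f (c *\<^sub>C x) = h c * f x" "\<And>c x. g (c *\<^sub>C x) = h c * g x"
  shows "csubspace {x. f x = g x}"
  using assms by (simp add: complex_vector.subspace_def)

lemma csubspace_image:
  fixes f :: "'v::complex_vector \<Rightarrow> 'w::complex_vector"
  assumes V: "csubspace V" and add: "\<And>x y. f (x + y) = f x + f y"
    and scale: "\<And>c x. f (c *\<^sub>C x) = c *\<^sub>C f x"
  shows "csubspace (f ` V)"
  unfolding complex_vector.subspace_def
proof (intro conjI ballI allI)
  have "f 0 = 0" using scale[of 0 0] by simp
  then show "0 \<in> f ` V" using complex_vector.subspace_0[OF V] by force
  show "x + y \<in> f ` V" if "x \<in> f ` V" "y \<in> f ` V" for x y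
    using that by (auto simp flip: add intro!: imageI complex_vector.subspace_add[OF V])
  show "c *\<^sub>C x \<in> f ` V" if "x \<in> f ` V" for c x
    using that by (auto simp flip: scale intro!: imageI complex_vector.subspace_scale[OF V])
qed

text \<open>The vectors \<open>w i\<close> only witness positivity: for a finite linear combination with the same
  coefficients of the \<open>u i\<close>, \<open>v i\<close> and \<open>w i\<close>, the hypothesis yields \<open>K\<^sup>2 \<parallel>u\<parallel>\<^sup>2 = \<parallel>v\<parallel>\<^sup>2 + \<parallel>w\<parallel>\<^sup>2\<close>,
  hence \<open>\<parallel>v\<parallel> \<le> K \<parallel>u\<parallel>\<close>. Spanning the triples \<open>(u i, v i, w i)\<close> in the product space keeps the
  coefficients in step.\<close>

lemma operator_of_gram:
  fixes u :: "'i \<Rightarrow> 'l::chilbert_space" and v :: "'i \<Rightarrow> 'm::chilbert_space"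
    and w :: "'i \<Rightarrow> 'n::chilbert_space"
  assumes gram: "\<And>i j. K\<^sup>2 *\<^sub>R cinner (u i) (u j) = cinner (v i) (v j) + cinner (w i) (w j)"
    and dense: "closure (cspan (range u)) = UNIV" and K: "K \<ge> 0"
  shows "\<exists>R :: 'l \<Rightarrow>\<^sub>L 'm. (\<forall>c x. blinfun_apply R (c *\<^sub>C x) = c *\<^sub>C R x) \<and>
    (\<forall>i. blinfun_apply R (u i) = v i) \<and> norm R \<le> K"
proof -
  define D where "D = range (\<lambda>i. (u i, v i, w i))"
  define E where "E p q \<longleftrightarrow> K\<^sup>2 *\<^sub>R cinner (fst p) (fst q) =
      cinner (fst (snd p)) (fst (snd q)) + cinner (snd (snd p)) (snd (snd q))"
    for p q :: "'l \<times> 'm \<times> 'n"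
  define G where "G = (\<lambda>p. (fst p, fst (snd p))) ` cspan D"
  have sub: "csubspace (cspan D)" by (rule complex_vector.subspace_span)
  have sub_right: "csubspace {q. E p q}" for p
    unfolding E_def
    by (rule csubspace_equalizer[where h = "\<lambda>c. c"])
      (simp_all add: scaleC_prod_def cinner_add_right cinner_scaleC_right algebra_simps)
  have sub_left: "csubspace {p. E p q}" for q
    unfolding E_def
    by (rule csubspace_equalizer[where h = cnj])
      (simp_all add: scaleC_prod_def cinner_add_left cinner_scaleC_left algebra_simps)
  have generators: "E p q" if "p \<in> D" "q \<in> D" for p q
    using that gram by (auto simp: D_def E_def)
  have "cspan D \<subseteq> {q. E p q}" if "p \<in> D" for p
    by (rule complex_vector.span_minimal[OF _ sub_right]) (use generators[OF that] in blast)
  then have "cspan D \<subseteq> {p. E p q}" if "q \<in> cspan D" for q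
    by (intro complex_vector.span_minimal[OF _ sub_left]) (use that in blast)
  then have E: "E p p" if "p \<in> cspan D" for p using that by blast
  have "\<exists>R :: 'l \<Rightarrow>\<^sub>L 'm. (\<forall>c x. blinfun_apply R (c *\<^sub>C x) = c *\<^sub>C R x) \<and>
      (\<forall>(a, b)\<in>G. blinfun_apply R a = b) \<and> norm R \<le> K"
  proof (rule operator_of_graph[OF _ _ _ K])
    show "csubspace G"
      unfolding G_def by (rule csubspace_image[OF sub]) (simp_all add: scaleC_prod_def)
    show "norm b \<le> K * norm a" if ab: "(a, b) \<in> G" for a b
    proof -
      obtain d where d: "(a, b, d) \<in> cspan D" using ab unfolding G_def by force
      have "K\<^sup>2 * (norm a)\<^sup>2 = (norm b)\<^sup>2 + (norm d)\<^sup>2"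
        using arg_cong[OF E[OF d, unfolded E_def], of Re] by (simp add: cinner_self del: of_real_power)
      then have "(norm b)\<^sup>2 \<le> (K * norm a)\<^sup>2" by (simp add: power_mult_distrib)
      then show ?thesis by (rule power2_le_imp_le) (simp add: K)
    qed
    have "cspan (range u) \<subseteq> fst ` cspan D"
    proof (rule complex_vector.span_minimal)
      show "range u \<subseteq> fst ` cspan D"
        using complex_vector.span_base[of _ D] by (force simp: D_def)
      show "csubspace (fst ` cspan D)"
        by (rule csubspace_image[OF sub]) (simp_all add: scaleC_prod_def)
    qed
    also have "fst ` cspan D = fst ` G" by (simp add: G_def image_image)
    finally show "closure (fst ` G) = UNIV" using closure_mono dense by blast
  qed
  then obtain R :: "'l \<Rightarrow>\<^sub>L 'm" where R: "\<forall>c x. blinfun_apply R (c *\<^sub>C x) = c *\<^sub>C R x"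
    "\<forall>(a, b)\<in>G. blinfun_apply R a = b" "norm R \<le> K" by auto
  have "(u i, v i) \<in> G" for i
    unfolding G_def
    by (rule image_eqI[of _ _ "(u i, v i, w i)"]) (auto simp: D_def intro!: complex_vector.span_base)
  then have "\<forall>i. blinfun_apply R (u i) = v i" using R(2) by fastforce
  with R(1,3) show ?thesis by (intro exI[of _ R] conjI)
qed

section \<open>Tensor products of operators\<close>

lemma hilbert_tensorD:
  assumes "hilbert_tensor \<tau>"
  shows "\<tau> (x + x') y = \<tau> x y + \<tau> x' y" "\<tau> x (y + y') = \<tau> x y + \<tau> x y'"
    "\<tau> (c *\<^sub>C x) y = c *\<^sub>C \<tau> x y" "\<tau> x (c *\<^sub>C y) = c *\<^sub>C \<tau> x y"
    "cinner (\<tau> x y) (\<tau> x' y') = cinner x x' * cinner y y'"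
    "closure (cspan {\<tau> x y | x y. True}) = UNIV"
  using assms unfolding hilbert_tensor_def by simp_all

lemma hilbert_tensor_swap:
  assumes "hilbert_tensor \<tau>"
  shows "hilbert_tensor (\<lambda>y x. \<tau> x y)"
proof -
  have "{\<tau> x y | y x. True} = {\<tau> x y | x y. True}" by blast
  then show ?thesis
    using hilbert_tensorD[OF assms] unfolding hilbert_tensor_def by (simp add: mult.commute)
qed

lemma tensor_vector_eqI:
  assumes \<tau>: "hilbert_tensor \<tau>" and eq: "\<And>x y. cinner (\<tau> x y) a = cinner (\<tau> x y) b"
  shows "a = b"
proof -
  have "closure (cspan {\<tau> x y | x y. True}) \<subseteq> {z. cinner z a = cinner z b}"
  proof (rule closure_cspan_minimal)
    show "csubspace {z. cinner z a = cinner z b}"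
      by (rule csubspace_equalizer[where h = cnj])
        (simp_all add: cinner_add_left cinner_scaleC_left)
    show "closed {z. cinner z a = cinner z b}"
      by (intro closed_Collect_eq bounded_bilinear.continuous_on[OF bounded_bilinear_cinner]
          continuous_intros)
  qed (use eq in auto)
  then have "cinner z a = cinner z b" for z
    using hilbert_tensorD(6)[OF \<tau>] by auto
  then show ?thesis by (rule cinner_left_eqI)
qed

lemma tensor_operator_eqI:
  fixes R R' :: "'l::chilbert_space op"
  assumes \<tau>: "hilbert_tensor \<tau>" and R: "R \<in> bounded_ops" "R' \<in> bounded_ops"
    and eq: "\<And>x y. R (\<tau> x y) = R' (\<tau> x y)"
  shows "R = R'"
proof (rule blinfun_eqI)
  have "closure (cspan {\<tau> x y | x y. True}) \<subseteq> {z. R z = R' z}"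
  proof (rule closure_cspan_minimal)
    show "csubspace {z. R z = R' z}"
      by (simp add: complex_vector.subspace_def blinfun.add_right bounded_ops_scaleC R)
    show "closed {z. R z = R' z}"
      by (intro closed_Collect_eq continuous_intros)
  qed (use eq in auto)
  then show "R z = R' z" for z
    using hilbert_tensorD(6)[OF \<tau>] by auto
qed

lemma norm_tensor:
  assumes "hilbert_tensor \<tau>"
  shows "norm (\<tau> x y) = norm x * norm y"
proof -
  have "(norm (\<tau> x y))\<^sup>2 = (norm x * norm y)\<^sup>2"
    using arg_cong[OF hilbert_tensorD(5)[OF assms, of x y x y], of cmod]
    by (simp only: norm_mult cmod_cinner_self power_mult_distrib)
  then show ?thesis by simp
qed

lemma bounded_linear_tensor_left:
  assumes "hilbert_tensor \<tau>"
  shows "bounded_linear (\<lambda>x. \<tau> x y)"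
  by (rule bounded_linear_intro[where K = "norm y"])
    (simp_all add: hilbert_tensorD[OF assms] norm_tensor[OF assms] scaleR_scaleC)

text \<open>Identities between operators on the triple tensor product can be checked on \<open>(x \<otimes> y) \<otimes> z\<close>, although
  density is only known separately for the vectors \<open>x \<otimes> y\<close> and \<open>w \<otimes> z\<close>.\<close>

lemma triple_tensor_operator_eqI:
  fixes R R' :: "'h3::chilbert_space op"
  assumes \<tau>: "hilbert_tensor \<tau>" and \<tau>l: "hilbert_tensor \<tau>l"
    and R: "R \<in> bounded_ops" "R' \<in> bounded_ops"
    and eq: "\<And>x y z. R (\<tau>l (\<tau> x y) z) = R' (\<tau>l (\<tau> x y) z)"
  shows "R = R'"
proof (rule tensor_operator_eqI[OF \<tau>l R])
  fix w z
  have zero: "\<tau>l 0 z = 0" using hilbert_tensorD(3)[OF \<tau>l, of 0 0 z] by simp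
  have "closure (cspan {\<tau> x y | x y. True}) \<subseteq> {w. R (\<tau>l w z) = R' (\<tau>l w z)}"
  proof (rule closure_cspan_minimal)
    show "csubspace {w. R (\<tau>l w z) = R' (\<tau>l w z)}"
      by (auto simp: complex_vector.subspace_def hilbert_tensorD[OF \<tau>l] blinfun.add_right
          bounded_ops_scaleC R zero)
    show "closed {w. R (\<tau>l w z) = R' (\<tau>l w z)}"
      by (intro closed_Collect_eq continuous_intros
          bounded_linear.continuous_on[OF bounded_linear_tensor_left[OF \<tau>l]])
  qed (use eq in auto)
  then show "R (\<tau>l w z) = R' (\<tau>l w z)"
    using hilbert_tensorD(6)[OF \<tau>] by auto
qed

text \<open>The operator \<open>S \<otimes> 1\<close>. The bound on its Gram matrix is the defect identity multiplied by the Gram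
  matrix of the second factors.\<close>

lemma tensor_left_operator:
  fixes \<tau> :: "'h::chilbert_space \<Rightarrow> 'k::chilbert_space \<Rightarrow> 'l::chilbert_space"
  assumes \<tau>: "hilbert_tensor \<tau>" and S: "S \<in> bounded_ops"
  shows "\<exists>R\<in>bounded_ops. (\<forall>x y. blinfun_apply R (\<tau> x y) = \<tau> (S x) y) \<and> norm R \<le> norm S"
proof -
  obtain Q :: "'h op" where
    Q: "\<And>x y. (norm S)\<^sup>2 *\<^sub>R cinner x y = cinner (S x) (S y) + cinner (Q x) (Q y)"
    using defect_operator[OF S] by blast
  have "\<exists>R :: 'l op. (\<forall>c x. blinfun_apply R (c *\<^sub>C x) = c *\<^sub>C R x) \<and>
      (\<forall>i. blinfun_apply R (case i of (x, y) \<Rightarrow> \<tau> x y) = (case i of (x, y) \<Rightarrow> \<tau> (S x) y)) \<and> norm R \<le> norm S"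
  proof (rule operator_of_gram[where w = "\<lambda>(x, y). \<tau> (Q x) y"])
    show "(norm S)\<^sup>2 *\<^sub>R cinner (case i of (x, y) \<Rightarrow> \<tau> x y) (case j of (x, y) \<Rightarrow> \<tau> x y) =
        cinner (case i of (x, y) \<Rightarrow> \<tau> (S x) y) (case j of (x, y) \<Rightarrow> \<tau> (S x) y) +
        cinner (case i of (x, y) \<Rightarrow> \<tau> (Q x) y) (case j of (x, y) \<Rightarrow> \<tau> (Q x) y)" for i j
    proof -
      obtain x y x' y' where ij: "i = (x, y)" "j = (x', y')" by (cases i, cases j)
      have "(norm S)\<^sup>2 *\<^sub>R (cinner x x' * cinner y y') =
          (cinner (S x) (S x') + cinner (Q x) (Q x')) * cinner y y'"
        by (simp only: Q flip: mult_scaleR_left)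
      then show ?thesis by (simp add: ij hilbert_tensorD(5)[OF \<tau>] distrib_right)
    qed
    have "range (\<lambda>(x, y). \<tau> x y) = {\<tau> x y | x y. True}" by auto
    then show "closure (cspan (range (\<lambda>(x, y). \<tau> x y))) = UNIV"
      using hilbert_tensorD(6)[OF \<tau>] by simp
  qed simp
  then show ?thesis by (auto simp: bounded_ops_def)
qed

lemma op_tensor_eqI:
  fixes \<tau> :: "'h::chilbert_space \<Rightarrow> 'k::chilbert_space \<Rightarrow> 'l::chilbert_space"
    and R :: "'l op" and S :: "'h op" and T :: "'k op"
  assumes "hilbert_tensor \<tau>" "R \<in> bounded_ops" "\<And>x y. R (\<tau> x y) = \<tau> (S x) (T y)"
  shows "op_tensor \<tau> S T = R"
  unfolding op_tensor_def
  using assms by (intro the_equality) (auto intro!: tensor_operator_eqI[OF assms(1)])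

lemma
  assumes \<tau>: "hilbert_tensor \<tau>" and S: "S \<in> bounded_ops" and T: "T \<in> bounded_ops"
  shows op_tensor_in_bounded_ops: "op_tensor \<tau> S T \<in> bounded_ops"
    and op_tensor_apply: "blinfun_apply (op_tensor \<tau> S T) (\<tau> x y) = \<tau> (S x) (T y)"
    and norm_op_tensor_le: "norm (op_tensor \<tau> S T) \<le> norm S * norm T"
proof -
  obtain P where P: "P \<in> bounded_ops" "\<And>x y. P (\<tau> x y) = \<tau> (S x) y" "norm P \<le> norm S"
    using tensor_left_operator[OF \<tau> S] by blast
  obtain Q where Q: "Q \<in> bounded_ops" "\<And>x y. Q (\<tau> x y) = \<tau> x (T y)" "norm Q \<le> norm T"
    using tensor_left_operator[OF hilbert_tensor_swap[OF \<tau>] T] by blast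
  have "op_tensor \<tau> S T = P o\<^sub>L Q"
    by (intro op_tensor_eqI \<tau> compose_in_bounded_ops) (simp_all add: P Q)
  moreover have "norm (P o\<^sub>L Q) \<le> norm S * norm T"
    by (rule order_trans[OF norm_blinfun_compose]) (simp add: mult_mono' P Q)
  ultimately show "op_tensor \<tau> S T \<in> bounded_ops" "blinfun_apply (op_tensor \<tau> S T) (\<tau> x y) = \<tau> (S x) (T y)"
    "norm (op_tensor \<tau> S T) \<le> norm S * norm T"
    using P Q by (simp_all add: compose_in_bounded_ops)
qed

lemma op_tensor_compose:
  assumes "hilbert_tensor \<tau>" "S \<in> bounded_ops" "T \<in> bounded_ops" "S' \<in> bounded_ops" "T' \<in> bounded_ops"
  shows "op_tensor \<tau> S T o\<^sub>L op_tensor \<tau> S' T' = op_tensor \<tau> (S o\<^sub>L S') (T o\<^sub>L T')"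
  by (rule op_tensor_eqI[symmetric])
    (simp_all add: assms compose_in_bounded_ops op_tensor_in_bounded_ops op_tensor_apply)

lemma op_tensor_id: "hilbert_tensor \<tau> \<Longrightarrow> op_tensor \<tau> id_blinfun id_blinfun = id_blinfun"
  by (rule op_tensor_eqI) (simp_all add: id_in_bounded_ops)

lemmas bounded_ops_add = complex_vector.subspace_add[OF csubspace_bounded_ops]
  and bounded_ops_scaleC_mem = complex_vector.subspace_scale[OF csubspace_bounded_ops]

lemma op_tensor_add_left:
  assumes "hilbert_tensor \<tau>" "S \<in> bounded_ops" "S' \<in> bounded_ops" "T \<in> bounded_ops"
  shows "op_tensor \<tau> (S + S') T = op_tensor \<tau> S T + op_tensor \<tau> S' T"
  by (rule op_tensor_eqI)
    (simp_all add: assms bounded_ops_add op_tensor_in_bounded_ops op_tensor_apply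
      blinfun.add_left hilbert_tensorD[OF assms(1)])

lemma op_tensor_scaleC_left:
  assumes "hilbert_tensor \<tau>" "S \<in> bounded_ops" "T \<in> bounded_ops"
  shows "op_tensor \<tau> (c *\<^sub>C S) T = c *\<^sub>C op_tensor \<tau> S T"
  by (rule op_tensor_eqI)
    (simp_all add: assms bounded_ops_scaleC_mem op_tensor_in_bounded_ops op_tensor_apply
      scaleC_blinfun_apply hilbert_tensorD[OF assms(1)])

lemma op_tensor_swap: "op_tensor (\<lambda>y x. \<tau> x y) T S = op_tensor \<tau> S T"
  unfolding op_tensor_def by (intro arg_cong[where f = The] ext) blast

lemma cadj_op_tensor:
  assumes "hilbert_tensor \<tau>" "S \<in> bounded_ops" "T \<in> bounded_ops"
  shows "cadj (op_tensor \<tau> S T) = op_tensor \<tau> (cadj S) (cadj T)"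
proof (rule op_tensor_eqI[symmetric])
  show "cadj (op_tensor \<tau> S T) (\<tau> x y) = \<tau> (cadj S x) (cadj T y)" for x y
    by (rule tensor_vector_eqI[OF assms(1)])
      (simp add: assms cinner_cadj_right op_tensor_in_bounded_ops op_tensor_apply
        hilbert_tensorD(5)[OF assms(1)])
qed (simp_all add: assms cadj_in_bounded_ops op_tensor_in_bounded_ops)

text \<open>Exchanging the factors preserves the inner products of elementary tensors, so the Gram matrices
  agree and the defect vectors are \<open>0\<close>.\<close>

lemma flip_operator_exists:
  fixes \<tau> :: "'h::chilbert_space \<Rightarrow> 'h \<Rightarrow> 'h2::chilbert_space"
  assumes \<tau>: "hilbert_tensor \<tau>"
  shows "\<exists>F\<in>bounded_ops. (\<forall>x y. blinfun_apply F (\<tau> x y) = \<tau> y x) \<and> F o\<^sub>L F = id_blinfun \<and> cadj F = F"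
proof -
  have "\<exists>F :: 'h2 op. (\<forall>c x. blinfun_apply F (c *\<^sub>C x) = c *\<^sub>C F x) \<and>
      (\<forall>i. blinfun_apply F (case i of (x, y) \<Rightarrow> \<tau> x y) = (case i of (x, y) \<Rightarrow> \<tau> y x)) \<and> norm F \<le> 1"
  proof (rule operator_of_gram[where w = "\<lambda>_. 0 :: 'h2"])
    have "range (\<lambda>(x, y). \<tau> x y) = {\<tau> x y | x y. True}" by auto
    then show "closure (cspan (range (\<lambda>(x, y). \<tau> x y))) = UNIV"
      using hilbert_tensorD(6)[OF \<tau>] by simp
  qed (simp_all add: hilbert_tensorD(5)[OF \<tau>] mult.commute split: prod.splits)
  then obtain F :: "'h2 op" where F: "F \<in> bounded_ops" "\<And>x y. F (\<tau> x y) = \<tau> y x"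
    by (auto simp: bounded_ops_def)
  have "F o\<^sub>L F = id_blinfun"
    by (rule tensor_operator_eqI[OF \<tau>]) (simp_all add: F compose_in_bounded_ops id_in_bounded_ops)
  moreover have "cadj F = F"
  proof (rule tensor_operator_eqI[OF \<tau>])
    show "cadj F (\<tau> x y) = F (\<tau> x y)" for x y
      by (rule tensor_vector_eqI[OF \<tau>])
        (simp add: cinner_cadj_right F hilbert_tensorD(5)[OF \<tau>])
  qed (simp_all add: F cadj_in_bounded_ops)
  ultimately show ?thesis using F by blast
qed

section \<open>Spatial tensor products and their morphisms\<close>

lemma blinfun_compose_assoc: "(R o\<^sub>L S) o\<^sub>L T = R o\<^sub>L (S o\<^sub>L T)"
  by (rule blinfun_eqI) simp

lemma blinfun_compose_scaleC_left: "(c *\<^sub>C S) o\<^sub>L T = c *\<^sub>C (S o\<^sub>L T)"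
  by (rule blinfun_eqI) (simp add: scaleC_blinfun_apply)

lemma blinfun_compose_scaleC_right:
  "S \<in> bounded_ops \<Longrightarrow> S o\<^sub>L (c *\<^sub>C T) = c *\<^sub>C (S o\<^sub>L T)"
  by (rule blinfun_eqI) (simp add: scaleC_blinfun_apply bounded_ops_scaleC)

lemma operator_algebra_closure_cspan:
  fixes D :: "'h::chilbert_space op set"
  assumes D: "operator_monoid D"
  shows "operator_algebra (closure (cspan D))"
proof -
  let ?B = "closure (cspan D)"
  have sub: "csubspace ?B" by (intro csubspace_closure complex_vector.subspace_span)
  have base: "D \<subseteq> ?B"
    using complex_vector.span_superset closure_subset by blast
  have "?B \<subseteq> bounded_ops"
    using operator_monoidD(1)[OF D]
    by (intro closure_cspan_minimal csubspace_bounded_ops closed_bounded_ops) auto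
  moreover have compose: "S o\<^sub>L T \<in> ?B" if S: "S \<in> ?B" and T: "T \<in> ?B" for S T
  proof -
    have sub_left: "csubspace {S. S o\<^sub>L T \<in> ?B}" for T :: "'h op"
      using sub by (simp add: complex_vector.subspace_def blinfun_compose_add_left
          blinfun_compose_scaleC_left)
    have sub_right: "csubspace {T. S o\<^sub>L T \<in> ?B}" if "S \<in> bounded_ops" for S
      using sub that by (simp add: complex_vector.subspace_def blinfun_compose_add_right
          blinfun_compose_scaleC_right)
    have closed_left: "closed {S. S o\<^sub>L T \<in> ?B}" for T :: "'h op"
      using closed_vimage[OF closed_closure bounded_bilinear.continuous_on[OF
          bounded_bilinear_blinfun_compose continuous_on_id continuous_on_const]]
      by (simp add: vimage_def)
    have closed_right: "closed {T. S o\<^sub>L T \<in> ?B}" for S :: "'h op"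
      using closed_vimage[OF closed_closure bounded_bilinear.continuous_on[OF
          bounded_bilinear_blinfun_compose continuous_on_const continuous_on_id]]
      by (simp add: vimage_def)
    have "?B \<subseteq> {T. S o\<^sub>L T \<in> ?B}" if "S \<in> D" for S
      using that operator_monoidD[OF D] base
      by (intro closure_cspan_minimal sub_right closed_right) auto
    then have "?B \<subseteq> {S. S o\<^sub>L T \<in> ?B}"
      using T by (intro closure_cspan_minimal sub_left closed_left) auto
    with S show ?thesis by auto
  qed
  ultimately show ?thesis
    using base operator_monoidD(2)[OF D] sub
    by (auto simp: operator_algebra_def operator_monoid_def)
qed

lemma operator_algebra_spatial_tensor:
  assumes \<tau>: "hilbert_tensor \<tau>" and B: "operator_monoid B" and C: "operator_monoid C"
  shows "operator_algebra (spatial_tensor \<tau> B C)"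
  unfolding spatial_tensor_def
proof (rule operator_algebra_closure_cspan)
  note mem = operator_monoidD[OF B] operator_monoidD[OF C]
  show "operator_monoid {op_tensor \<tau> S T | S T. S \<in> B \<and> T \<in> C}"
    unfolding operator_monoid_def
  proof (intro conjI ballI subsetI)
    show "id_blinfun \<in> {op_tensor \<tau> S T | S T. S \<in> B \<and> T \<in> C}"
      using op_tensor_id[OF \<tau>] mem by (metis (mono_tags, lifting) CollectI)
  next
    fix P Q
    assume "P \<in> {op_tensor \<tau> S T | S T. S \<in> B \<and> T \<in> C}"
      and "Q \<in> {op_tensor \<tau> S T | S T. S \<in> B \<and> T \<in> C}"
    then obtain S T S' T' where "P = op_tensor \<tau> S T" "Q = op_tensor \<tau> S' T'"
      and ST: "S \<in> B" "T \<in> C" "S' \<in> B" "T' \<in> C" by blast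
    then have "P o\<^sub>L Q = op_tensor \<tau> (S o\<^sub>L S') (T o\<^sub>L T')"
      by (simp add: op_tensor_compose[OF \<tau>] mem)
    with ST mem show "P o\<^sub>L Q \<in> {op_tensor \<tau> S T | S T. S \<in> B \<and> T \<in> C}" by blast
  qed (auto intro!: op_tensor_in_bounded_ops[OF \<tau>] mem)
qed

lemma op_tensor_in_spatial_tensor:
  "S \<in> B \<Longrightarrow> T \<in> C \<Longrightarrow> op_tensor \<tau> S T \<in> spatial_tensor \<tau> B C"
  unfolding spatial_tensor_def
  by (intro subsetD[OF closure_subset] complex_vector.span_base) blast

text \<open>A bounded *-morphism of all bounded operators is confined to a closed subspace as soon as its
  values on generators are.\<close>

lemma star_morphism_restrict:
  fixes \<Phi> :: "'h::chilbert_space op \<Rightarrow> 'k::chilbert_space op"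
  assumes \<Phi>: "star_morphism bounded_ops bounded_ops \<Phi>"
    and bound: "\<And>T. T \<in> bounded_ops \<Longrightarrow> norm (\<Phi> T) \<le> K * norm T"
    and D: "D \<subseteq> bounded_ops" and E: "csubspace E" "closed E" and DE: "\<Phi> ` D \<subseteq> E"
  shows "star_morphism (closure (cspan D)) E \<Phi>"
proof -
  have add: "\<Phi> (S + T) = \<Phi> S + \<Phi> T" if "S \<in> bounded_ops" "T \<in> bounded_ops" for S T
    using \<Phi> that by (simp add: star_morphism_def)
  have scaleC: "\<Phi> (c *\<^sub>C T) = c *\<^sub>C \<Phi> T" if "T \<in> bounded_ops" for c T
    using \<Phi> that by (simp add: star_morphism_def)
  have zero: "\<Phi> 0 = 0"
    using bound[OF complex_vector.subspace_0[OF csubspace_bounded_ops]] by simp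
  have "closure (cspan D) \<subseteq> {T \<in> bounded_ops. \<Phi> T \<in> E}"
  proof (rule closure_cspan_minimal)
    show "D \<subseteq> {T \<in> bounded_ops. \<Phi> T \<in> E}" using D DE by auto
    show "csubspace {T \<in> bounded_ops. \<Phi> T \<in> E}"
      using E(1) csubspace_bounded_ops[where 'h = 'h]
      by (simp add: complex_vector.subspace_def zero add scaleC)
    show "closed {T \<in> bounded_ops. \<Phi> T \<in> E}"
      unfolding closed_sequential_limits
    proof (intro allI impI, elim conjE)
      fix f T assume f: "\<forall>n. f n \<in> {T \<in> bounded_ops. \<Phi> T \<in> E}" "f \<longlonglongrightarrow> T"
      have T: "T \<in> bounded_ops"
        using closed_sequentially[OF closed_bounded_ops, of f] f by auto
      have "norm (\<Phi> (f n) - \<Phi> T) \<le> K * norm (f n - T)" for n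
      proof -
        have *: "f n - T \<in> bounded_ops"
          using f T by (intro complex_vector.subspace_diff[OF csubspace_bounded_ops]) auto
        have "\<Phi> (f n) = \<Phi> (f n - T) + \<Phi> T" using add[OF * T] by simp
        with bound[OF *] show ?thesis by simp
      qed
      moreover have "(\<lambda>n. K * norm (f n - T)) \<longlonglongrightarrow> 0"
        using f(2) by (intro tendsto_mult_right_zero tendsto_norm_zero) (rule LIM_zero)
      ultimately have "(\<lambda>n. \<Phi> (f n) - \<Phi> T) \<longlonglongrightarrow> 0"
        by (rule Lim_null_comparison[OF always_eventually, OF allI])
      then have "(\<lambda>n. \<Phi> (f n)) \<longlonglongrightarrow> \<Phi> T" by (rule LIM_zero_cancel)
      then have "\<Phi> T \<in> E"
        using closed_sequentially[OF E(2), of "\<lambda>n. \<Phi> (f n)"] f(1) by auto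
      with T show "T \<in> {T \<in> bounded_ops. \<Phi> T \<in> E}" by simp
    qed
  qed
  then show ?thesis
    using \<Phi> unfolding star_morphism_def by blast
qed

text \<open>A selfadjoint \<open>U\<close> with \<open>U\<^sup>2 = 1\<close> is unitary and its own adjoint.\<close>

lemma star_morphism_conjugation:
  assumes \<Theta>: "star_morphism bounded_ops bounded_ops \<Theta>"
    and U: "U \<in> bounded_ops" "U o\<^sub>L U = id_blinfun" "cadj U = U"
  shows "star_morphism bounded_ops bounded_ops (\<lambda>T. U o\<^sub>L \<Theta> T o\<^sub>L U)"
proof -
  have mem: "\<Theta> T \<in> bounded_ops" if "T \<in> bounded_ops" for T
    using \<Theta> that by (auto simp: star_morphism_def)
  have UU: "U (U x) = x" for x
    using arg_cong[OF U(2), of "\<lambda>T. blinfun_apply T x"] by simp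
  have "U o\<^sub>L (\<Theta> S o\<^sub>L \<Theta> T) o\<^sub>L U = (U o\<^sub>L \<Theta> S o\<^sub>L U) o\<^sub>L (U o\<^sub>L \<Theta> T o\<^sub>L U)" for S T
    by (rule blinfun_eqI) (simp add: UU)
  moreover have "U o\<^sub>L cadj (\<Theta> T) o\<^sub>L U = cadj (U o\<^sub>L \<Theta> T o\<^sub>L U)" if "T \<in> bounded_ops" for T
    using mem[OF that]
    by (simp add: cadj_compose compose_in_bounded_ops U blinfun_compose_assoc)
  ultimately show ?thesis
    using \<Theta> mem unfolding star_morphism_def
    by (auto simp: compose_in_bounded_ops U(1) blinfun_compose_add_left blinfun_compose_add_right
        blinfun_compose_scaleC_left blinfun_compose_scaleC_right)
qed

lemma star_morphism_linear:
  assumes "star_morphism B C \<Phi>" "csubspace B" "S \<in> B" "T \<in> B"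
  shows "\<Phi> (S + r *\<^sub>R T) = \<Phi> S + r *\<^sub>R \<Phi> T"
  using assms unfolding star_morphism_def
  by (simp add: scaleR_scaleC complex_vector.subspace_scale)

lemma norm_conjugation_le:
  "norm (U o\<^sub>L T o\<^sub>L U) \<le> (norm U)\<^sup>2 * norm (T :: 'h::real_normed_vector \<Rightarrow>\<^sub>L 'h)"
proof -
  have "norm (U o\<^sub>L T o\<^sub>L U) \<le> norm (U o\<^sub>L T) * norm U" by (rule norm_blinfun_compose)
  also have "\<dots> \<le> (norm U * norm T) * norm U"
    by (intro mult_right_mono norm_blinfun_compose) simp
  finally show ?thesis by (simp add: power2_eq_square ac_simps)
qed

text \<open>Conjugation by the exchange of the tensor factors meets the specification of \<open>flip_map\<close>, so the
  chosen map is a *-morphism as well.\<close>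

lemma star_morphism_flip_map:
  assumes \<tau>: "hilbert_tensor \<tau>" and A: "operator_monoid A"
  shows "star_morphism (spatial_tensor \<tau> A A) (spatial_tensor \<tau> A A) (flip_map \<tau> A)"
proof -
  note A_ops = operator_monoidD(1)[OF A]
  obtain F where F: "F \<in> bounded_ops" "\<And>x y. blinfun_apply F (\<tau> x y) = \<tau> y x"
    "F o\<^sub>L F = id_blinfun" "cadj F = F"
    using flip_operator_exists[OF \<tau>] by blast
  let ?\<Phi> = "\<lambda>T. F o\<^sub>L T o\<^sub>L F"
  have elementary: "?\<Phi> (op_tensor \<tau> a b) = op_tensor \<tau> b a" if "a \<in> A" "b \<in> A" for a b
    by (rule op_tensor_eqI[symmetric, OF \<tau>])
      (simp_all add: that A_ops F op_tensor_apply[OF \<tau>] op_tensor_in_bounded_ops[OF \<tau>]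
        compose_in_bounded_ops)
  have "star_morphism (spatial_tensor \<tau> A A) (spatial_tensor \<tau> A A) ?\<Phi>"
    unfolding spatial_tensor_def[of \<tau> A A]
  proof (rule star_morphism_restrict)
    show "star_morphism bounded_ops bounded_ops ?\<Phi>"
      by (rule star_morphism_conjugation[where \<Theta> = "\<lambda>T. T"])
        (use F in \<open>simp_all add: star_morphism_def\<close>)
    show "norm (?\<Phi> T) \<le> (norm F)\<^sup>2 * norm T" for T by (rule norm_conjugation_le)
    show "{op_tensor \<tau> S T | S T. S \<in> A \<and> T \<in> A} \<subseteq> bounded_ops"
      by (auto intro!: op_tensor_in_bounded_ops[OF \<tau>] A_ops)
    show "?\<Phi> ` {op_tensor \<tau> S T | S T. S \<in> A \<and> T \<in> A}
        \<subseteq> closure (cspan {op_tensor \<tau> S T | S T. S \<in> A \<and> T \<in> A})"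
      using op_tensor_in_spatial_tensor[of _ A _ A \<tau>]
      unfolding spatial_tensor_def by (auto simp: elementary)
  qed (simp_all add: csubspace_closure)
  with elementary have "\<exists>\<Phi>. star_morphism (spatial_tensor \<tau> A A) (spatial_tensor \<tau> A A) \<Phi> \<and>
      (\<forall>a\<in>A. \<forall>b\<in>A. \<Phi> (op_tensor \<tau> a b) = op_tensor \<tau> b a)" by blast
  then show ?thesis unfolding flip_map_def by (rule someI2_ex) simp
qed

text \<open>In \<open>T \<otimes> 1\<close> the unit stands in the third place; conjugation by \<open>W = 1 \<otimes> F\<close>, which exchanges the
  second and the third factor, moves it to the middle.\<close>

lemma star_morphism_middle_unit_map:
  assumes tensors: "hilbert_tensor_powers \<tau> \<tau>l \<tau>r" and A: "operator_monoid A"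
  shows "star_morphism (spatial_tensor \<tau> A A) (spatial_tensor \<tau>l (spatial_tensor \<tau> A A) A)
    (middle_unit_map \<tau> \<tau>l A)"
proof -
  have \<tau>: "hilbert_tensor \<tau>" and \<tau>l: "hilbert_tensor \<tau>l" and \<tau>r: "hilbert_tensor \<tau>r"
    and assoc: "\<And>x y z. \<tau>l (\<tau> x y) z = \<tau>r x (\<tau> y z)"
    using tensors by (simp_all add: hilbert_tensor_powers_def)
  note A_ops = operator_monoidD(1)[OF A]
  obtain F where F: "F \<in> bounded_ops" "\<And>x y. blinfun_apply F (\<tau> x y) = \<tau> y x"
    "F o\<^sub>L F = id_blinfun" "cadj F = F"
    using flip_operator_exists[OF \<tau>] by blast
  define W where "W = op_tensor \<tau>r id_blinfun F"
  have cadj_id: "cadj id_blinfun = (id_blinfun :: 'a op)"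
    by (rule cadj_eqI) simp
  have W: "W \<in> bounded_ops" "W o\<^sub>L W = id_blinfun" "cadj W = W"
    unfolding W_def
    by (simp_all add: op_tensor_in_bounded_ops op_tensor_compose cadj_op_tensor op_tensor_id
        \<tau>r F id_in_bounded_ops cadj_id)
  have W_apply: "W (\<tau>l (\<tau> x y) z) = \<tau>l (\<tau> x z) y" for x y z
    unfolding assoc W_def by (simp add: op_tensor_apply \<tau>r F id_in_bounded_ops)
  let ?\<Theta> = "\<lambda>T. op_tensor \<tau>l T id_blinfun"
  let ?\<Phi> = "\<lambda>T. W o\<^sub>L ?\<Theta> T o\<^sub>L W"
  have elementary: "?\<Phi> (op_tensor \<tau> a b) = op_tensor \<tau>l (op_tensor \<tau> a id_blinfun) b"
    if "a \<in> A" "b \<in> A" for a b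
    by (rule triple_tensor_operator_eqI[OF \<tau> \<tau>l])
      (simp_all add: that A_ops W W_apply op_tensor_apply op_tensor_in_bounded_ops
        compose_in_bounded_ops id_in_bounded_ops \<tau> \<tau>l)
  have "star_morphism (spatial_tensor \<tau> A A) (spatial_tensor \<tau>l (spatial_tensor \<tau> A A) A) ?\<Phi>"
    unfolding spatial_tensor_def[of \<tau> A A]
  proof (rule star_morphism_restrict)
    show "star_morphism bounded_ops bounded_ops ?\<Phi>"
    proof (rule star_morphism_conjugation[OF _ W])
      show "star_morphism bounded_ops bounded_ops ?\<Theta>"
        unfolding star_morphism_def
        by (auto simp: op_tensor_in_bounded_ops op_tensor_add_left op_tensor_scaleC_left
            op_tensor_compose cadj_op_tensor cadj_id id_in_bounded_ops \<tau>l)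
    qed
    show "norm (?\<Phi> T) \<le> (norm W)\<^sup>2 * norm T" if "T \<in> bounded_ops" for T
    proof -
      have "norm (?\<Theta> T) \<le> norm T * norm (id_blinfun :: 'a op)"
        by (rule norm_op_tensor_le[OF \<tau>l that id_in_bounded_ops])
      also have "\<dots> \<le> norm T * 1"
        by (intro mult_left_mono norm_blinfun_id_le) simp
      finally have "(norm W)\<^sup>2 * norm (?\<Theta> T) \<le> (norm W)\<^sup>2 * norm T"
        by (intro mult_left_mono) simp_all
      with norm_conjugation_le[of W "?\<Theta> T"] show ?thesis by linarith
    qed
    show "{op_tensor \<tau> S T | S T. S \<in> A \<and> T \<in> A} \<subseteq> bounded_ops"
      by (auto intro!: op_tensor_in_bounded_ops[OF \<tau>] A_ops)
    let ?E = "spatial_tensor \<tau>l (closure (cspan {op_tensor \<tau> S T | S T. S \<in> A \<and> T \<in> A})) A"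
    show "?\<Phi> ` {op_tensor \<tau> S T | S T. S \<in> A \<and> T \<in> A} \<subseteq> ?E"
      unfolding spatial_tensor_def[of \<tau> A A, symmetric]
      by (auto simp: elementary operator_monoidD(2)[OF A] intro!: op_tensor_in_spatial_tensor)
    show "csubspace ?E" "closed ?E"
      by (simp_all add: spatial_tensor_def csubspace_closure)
  qed
  with elementary have "\<exists>\<Phi>. star_morphism (spatial_tensor \<tau> A A)
        (spatial_tensor \<tau>l (spatial_tensor \<tau> A A) A) \<Phi> \<and>
      (\<forall>a\<in>A. \<forall>b\<in>A. \<Phi> (op_tensor \<tau> a b) = op_tensor \<tau>l (op_tensor \<tau> a id_blinfun) b)" by blast
  then show ?thesis unfolding middle_unit_map_def by (rule someI2_ex) simp
qed

section \<open>Sums of quantum metrics\<close>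

text \<open>If \<open>S = U* U\<close> and \<open>T = V* V\<close>, pairing the hypothesis with \<open>x\<close> gives
  \<open>\<parallel>U x\<parallel>\<^sup>2 + r \<parallel>V x\<parallel>\<^sup>2 = 0\<close>.\<close>

lemma kernel_add_positive:
  fixes S T :: "'h::chilbert_space op"
  assumes B: "B \<subseteq> bounded_ops" and pos: "positive_in B S" "positive_in B T"
    and r: "r > 0" and zero: "S x + r *\<^sub>R T x = 0"
  shows "S x = 0"
proof -
  obtain U V where U: "U \<in> B" "S = cadj U o\<^sub>L U" and V: "V \<in> B" "T = cadj V o\<^sub>L V"
    using pos unfolding positive_in_def by blast
  have "(norm (U x))\<^sup>2 + r * (norm (V x))\<^sup>2 = Re (cinner x (S x + r *\<^sub>R T x))"
  proof -
    have "U \<in> bounded_ops" "V \<in> bounded_ops" using U(1) V(1) B by auto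
    then show ?thesis
      by (simp add: U(2) V(2) cinner_add_right cinner_scaleR_right cinner_cadj_right cinner_self
          del: of_real_power)
  qed
  also have "\<dots> = 0" by (simp add: zero)
  finally have "(norm (U x))\<^sup>2 = 0"
    using r by (simp add: add_nonneg_eq_0_iff)
  then show ?thesis by (simp add: U(2))
qed

theorem theorem1:
  fixes \<pi> :: "'a::unital_cstar_algebra \<Rightarrow> 'h::chilbert_space op"
    and \<tau> :: "'h \<Rightarrow> 'h \<Rightarrow> 'h2::chilbert_space"
    and \<tau>l :: "'h2 \<Rightarrow> 'h \<Rightarrow> 'h3::chilbert_space"
    and \<tau>r :: "'h \<Rightarrow> 'h2 \<Rightarrow> 'h3"
    and \<rho>1 \<rho>2 :: "'h2 op"
    and r :: real
  assumes "hilbert_tensor_powers \<tau> \<tau>l \<tau>r"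
    and "atomic_representation \<pi>" and "inj \<pi>"
    and "quantum_metric \<tau> \<tau>l \<tau>r \<pi> \<rho>1"
    and "quantum_metric \<tau> \<tau>l \<tau>r \<pi> \<rho>2"
    and "r > 0"
  shows "quantum_metric \<tau> \<tau>l \<tau>r \<pi> (\<rho>1 + r *\<^sub>R \<rho>2)"
proof -
  have \<tau>: "hilbert_tensor \<tau>" and \<tau>l: "hilbert_tensor \<tau>l" and \<tau>r: "hilbert_tensor \<tau>r"
    using assms(1) by (simp_all add: hilbert_tensor_powers_def)
  define A where "A = range \<pi>"
  define A2 where "A2 = spatial_tensor \<tau> A A"
  define A3 where "A3 = spatial_tensor \<tau>l A2 A"
  define M where "M = middle_unit_map \<tau> \<tau>l A"
  define S where "S \<rho> = op_tensor \<tau>l \<rho> id_blinfun + op_tensor \<tau>r id_blinfun \<rho>" for \<rho>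
  let ?P = "P_delta \<tau> A"
  have qm: "quantum_metric \<tau> \<tau>l \<tau>r \<pi> \<rho> \<longleftrightarrow> \<rho> \<in> A2 \<and> positive_in A2 \<rho> \<and>
      \<rho> o\<^sub>L ?P = 0 \<and> ?P o\<^sub>L \<rho> = 0 \<and> \<not> eigenvalue_on (orth_compl (H_delta \<tau> A)) \<rho> 0 \<and>
      flip_map \<tau> A \<rho> = \<rho> \<and> le_in A3 (M \<rho>) (S \<rho>)" for \<rho>
    by (simp add: quantum_metric_def Let_def A_def A2_def A3_def M_def S_def)
  note \<rho>1 = assms(4)[unfolded qm] and \<rho>2 = assms(5)[unfolded qm]
  have rep: "representation \<pi>"
    using assms(2) by (simp add: atomic_representation_def)
  have A: "operator_monoid A"
    unfolding operator_monoid_def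
  proof (intro conjI ballI)
    show "A \<subseteq> bounded_ops" using rep by (simp add: representation_def A_def)
    show "id_blinfun \<in> A"
      using rep by (metis A_def rangeI representation_def)
    have "\<pi> a o\<^sub>L \<pi> b = \<pi> (a * b)" for a b
      using rep by (simp add: representation_def)
    then show "T o\<^sub>L T' \<in> A" if "T \<in> A" "T' \<in> A" for T T'
      using that by (auto simp: A_def)
  qed
  have A2: "operator_algebra A2"
    unfolding A2_def by (rule operator_algebra_spatial_tensor[OF \<tau> A A])
  have A3: "operator_algebra A3"
    unfolding A3_def
    by (rule operator_algebra_spatial_tensor[OF \<tau>l operator_algebraD(1)[OF A2] A])
  have A2_ops: "A2 \<subseteq> bounded_ops" using A2 by (auto simp: operator_algebra_def operator_monoid_def)
  note A2_sub = operator_algebraD(2)[OF A2] and A3_sub = operator_algebraD(2)[OF A3]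
  let ?\<rho> = "\<rho>1 + r *\<^sub>R \<rho>2"
  have r2: "r *\<^sub>R \<rho>2 \<in> A2" by (rule csubspace_scaleR[OF A2_sub]) (use \<rho>2 in blast)
  have mem: "?\<rho> \<in> A2"
    by (rule complex_vector.subspace_add[OF A2_sub _ r2]) (use \<rho>1 in blast)
  have pos: "positive_in A2 ?\<rho>"
    by (intro positive_in_add[OF A2 _ r2] positive_in_scaleR[OF A2])
      (use \<rho>1 \<rho>2 \<open>r > 0\<close> in auto)
  have P: "?\<rho> o\<^sub>L ?P = 0" "?P o\<^sub>L ?\<rho> = 0"
    using \<rho>1 \<rho>2
    by (simp_all add: blinfun_compose_add_left blinfun_compose_add_right
        blinfun_compose_scaleR_left blinfun_compose_scaleR_right)
  have eig: "\<not> eigenvalue_on (orth_compl (H_delta \<tau> A)) ?\<rho> 0"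
  proof
    assume "eigenvalue_on (orth_compl (H_delta \<tau> A)) ?\<rho> 0"
    then obtain x where x: "x \<in> orth_compl (H_delta \<tau> A)" "x \<noteq> 0" "\<rho>1 x + r *\<^sub>R \<rho>2 x = 0"
      by (auto simp: eigenvalue_on_def blinfun.add_left blinfun.scaleR_left)
    have "\<rho>1 x = 0"
      using kernel_add_positive[OF A2_ops _ _ \<open>r > 0\<close> x(3)] \<rho>1 \<rho>2 by blast
    with x \<rho>1 show False by (auto simp: eigenvalue_on_def)
  qed
  have flip: "flip_map \<tau> A ?\<rho> = ?\<rho>"
    using star_morphism_linear[OF star_morphism_flip_map[OF \<tau> A, folded A2_def] A2_sub] \<rho>1 \<rho>2
    by simp
  have M: "M ?\<rho> = M \<rho>1 + r *\<^sub>R M \<rho>2"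
    using star_morphism_linear[OF star_morphism_middle_unit_map[OF assms(1) A,
          folded A2_def A3_def M_def] A2_sub] \<rho>1 \<rho>2
    by simp
  have S: "S ?\<rho> = S \<rho>1 + r *\<^sub>R S \<rho>2"
  proof -
    have "\<rho>1 \<in> bounded_ops" "\<rho>2 \<in> bounded_ops" using \<rho>1 \<rho>2 A2_ops by auto
    \<comment> \<open>A general tensor product \<open>\<sigma>\<close>, because \<open>1 \<otimes> \<rho>\<close> is \<open>\<rho> \<otimes> 1\<close> for the product with swapped factors.\<close>
    moreover have "op_tensor \<sigma> ?\<rho> id_blinfun =
        op_tensor \<sigma> \<rho>1 id_blinfun + r *\<^sub>R op_tensor \<sigma> \<rho>2 id_blinfun"
      if "hilbert_tensor \<sigma>" "\<rho>1 \<in> bounded_ops" "\<rho>2 \<in> bounded_ops" for \<sigma> :: "'h2 \<Rightarrow> 'h \<Rightarrow> 'h3"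
      using that by (simp add: op_tensor_add_left op_tensor_scaleC_left scaleR_scaleC
          bounded_ops_scaleC_mem id_in_bounded_ops)
    ultimately show ?thesis
      using \<tau>l hilbert_tensor_swap[OF \<tau>r]
      by (simp add: S_def scaleR_add_right flip: op_tensor_swap[of \<tau>r])
  qed
  have "le_in A3 (M ?\<rho>) (S ?\<rho>)"
    unfolding le_in_def
  proof (intro conjI)
    have M_mem: "M \<rho>1 \<in> A3" "M \<rho>2 \<in> A3" and S_mem: "S \<rho>1 \<in> A3" "S \<rho>2 \<in> A3"
      and p: "positive_in A3 (S \<rho>1 - M \<rho>1)" "positive_in A3 (S \<rho>2 - M \<rho>2)"
      using \<rho>1 \<rho>2 by (simp_all add: le_in_def)
    then show "M ?\<rho> \<in> A3" "S ?\<rho> \<in> A3"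
      unfolding M S
      by (simp_all add: complex_vector.subspace_add[OF A3_sub] csubspace_scaleR[OF A3_sub])
    \<comment> \<open>The defect in the triangle inequality is linear in the metric.\<close>
    have "positive_in A3 ((S \<rho>1 - M \<rho>1) + r *\<^sub>R (S \<rho>2 - M \<rho>2))"
      using \<open>r > 0\<close>
      by (intro positive_in_add[OF A3] positive_in_scaleR[OF A3] p csubspace_scaleR[OF A3_sub]
          complex_vector.subspace_diff[OF A3_sub] M_mem S_mem) simp
    then show "positive_in A3 (S ?\<rho> - M ?\<rho>)"
      unfolding M S by (simp add: algebra_simps)
  qed
  with mem pos P eig flip show ?thesis unfolding qm by blast
qed

end
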